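(* Let $X$ be a BMC with kernel $\mathcal P$ and arbitrary initial distribution $\nu$ such that (G) and (K) hold, and let ${\mathfrak f}_n=(f_{\ell,n},0\le\ell\le n)$, $n\in\mathbb N$, satisfy Assumption (F) with the same $\gamma$ as in (K), and with $\sigma^2>0$. If $\alpha>1/2$, assume moreover $2^{1-d\gamma}\alpha<1$. Let $(b_n)$ be positive with $b_n\to\infty$, $n^{3/2}b_n/\sqrt{2^nh_n^d}\to0$ and, for some $s>0$, $b_n/\sqrt{2^nh_n^{2s+d}}\to\infty$. Then $b_n^{-1}N_{n,\emptyset}({\mathfrak f}_n)$ satisfies a moderate deviation principle on $\mathbb R$ with speed $b_n^2$ and rate function $I(y)=y^2/(2\sigma^2)$, $\sigma^2$ as in (F)(iii).
   Context: Binary tree: $\mathbb G_0=\{\emptyset\}$, $\mathbb G_k=\{0,1\}^k$, $\mathbb T_n=\bigcup_{k\le n}\mathbb G_k$, $\mathbb T=\bigcup_k\mathbb G_k$, $|\mathbb G_n|=2^n$. $S=\mathbb R^d$. $\mathcal P$ a probability kernel from $S$ to $S^2$; $\mathcal Ph(x)=\int h(y,z)\mathcal P(x,dy,dz)$ for $h$ on $S^2$; $\mathcal P_0(x,B)=\mathcal P(x,B\times S)$, $\mathcal P_1(x,B)=\mathcal P(x,S\times B)$, $\mathcal Q=(\mathcal P_0+\mathcal P_1)/2$; $(f\otimes g)(y,z)=f(y)g(z)$, $f\otimes^2=f\otimes f$. BMC: $X=(X_i)_{i\in\mathbb T}$, $X_\emptyset\sim\nu$, $\mathbb E[\prod_{i\in\mathbb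 G_k}g_i(X_i,X_{i0},X_{i1})\mid\sigma(X_j,j\in\mathbb T_k)]=\prod_{i\in\mathbb G_k}\int g_i(X_i,y,z)\mathcal P(X_i,dy,dz)$. (G) $\mathcal P$ has a Lebesgue density; $\mathcal Q$ has invariant probability $\mu$; there exist $M>0$, $\alpha\in(0,1)$ with $\|\mathcal Q^nf-\langle\mu,f\rangle\|_\infty\le M\alpha^n\|f\|_\infty$ for all bounded measurable $f$, $n$. (K) $K$ bounded, in $L^1\cap L^2$, $\int K=1$, $|x|K(x)\to0$; $h_n=2^{-n\gamma}$ with fixed $\gamma\in(0,1/d)$. (F) For each $n$, $f_{\ell,n}:S\to\mathbb R$ measurable ($0\le\ell\le n$; $f_{\ell,n}=0$ for $\ell>n$), and: (i) $\sup_n\sup_{0\le\ell\le n}\max\{h_n^{d/2}\|f_{\ell,n}\|_\infty,\ h_n^{-d/2}\|\mathcal Qf_{\ell,n}\|_\infty,\ \|\mathcal Q(f_{\ell,n}^2)\|_\infty,\ h_n^{-d}\|\mathcal P(f_{\ell,n}\otimes^2)\|_\infty\}<\infty$ (note $h_n^{d/2}=2^{-d\gamma n/2}$); (ii) $\sup_n\sup_{0\le\ell\le n}\max\{h_n^{-d/2}\langle\mu,|f_{\ell,n}|\rangle,\ \langle\mu,f_{\ell,n}^2\rangle\}<\infty$; (iii) $\sigma^2=\lim_{n\to\infty}\sum_{\ell=0}^n2^{-\ell}\|f_{\ell,n}\|^2_{L^2(\mu)}$ exists and is finite. Notation: $M_{\mathbb A}(f)=\sum_{i\in\mathbb A}f(X_i)$;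 $\tilde f=f-\langle\mu,f\rangle$; $N_{n,\emptyset}({\mathfrak f}_n)=|\mathbb G_n|^{-1/2}\sum_{\ell=0}^nM_{\mathbb G_{n-\ell}}(\tilde f_{\ell,n})$. MDP with speed $b_n^2$ and rate $I$: for every Borel $A\subset\mathbb R$, $-\inf_{\mathring A}I\le\liminf b_n^{-2}\log\mathbb P(Z_n\in A)\le\limsup b_n^{-2}\log\mathbb P(Z_n\in A)\le-\inf_{\bar A}I$. *)

theory Defs
  imports "HOL-Probability.Probability"
begin

text \<open>Binary tree: vertices are bool lists; the children of i are i@[False] (i0) and i@[True] (i1).
  G k is the k-th generation, T k the tree up to generation k.\<close>

definition G :: "nat \<Rightarrow> bool list set" where
  "G k = {u. length u = k}"

definition T :: "nat \<Rightarrow> bool list set" where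
  "T k = {u. length u \<le> k}"

definition Pop :: "('a \<Rightarrow> ('a \<times> 'a) measure) \<Rightarrow> ('a \<Rightarrow> 'a \<Rightarrow> real) \<Rightarrow> 'a \<Rightarrow> real" where
  "Pop P h x = (\<integral>yz. h (fst yz) (snd yz) \<partial>(P x))"

definition Qop :: "('a \<Rightarrow> ('a \<times> 'a) measure) \<Rightarrow> ('a \<Rightarrow> real) \<Rightarrow> 'a \<Rightarrow> real" where
  "Qop P f x = ((\<integral>yz. f (fst yz) \<partial>(P x)) + (\<integral>yz. f (snd yz) \<partial>(P x))) / 2"

definition bw :: "real \<Rightarrow> nat \<Rightarrow> real" where
  "bw \<gamma> n = 2 powr (- real n * \<gamma>)"

definition BMC :: "'w measure \<Rightarrow> (bool list \<Rightarrow> 'w \<Rightarrow> 'a::euclidean_space)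
    \<Rightarrow> ('a \<Rightarrow> ('a \<times> 'a) measure) \<Rightarrow> 'a measure \<Rightarrow> bool" where
  "BMC M X P \<nu> \<longleftrightarrow>
     prob_space M \<and>
     (\<forall>i. X i \<in> borel_measurable M) \<and>
     distr M borel (X []) = \<nu> \<and>
     (\<forall>k (g :: bool list \<Rightarrow> 'a \<Rightarrow> 'a \<Rightarrow> 'a \<Rightarrow> real).
        (\<forall>i. (\<lambda>(x, y, z). g i x y z) \<in> borel_measurable borel) \<longrightarrow>
        (\<forall>i. \<exists>B. \<forall>x y z. \<bar>g i x y z\<bar> \<le> B) \<longrightarrow>
        (AE \<omega> in M.
           real_cond_exp M
             (sigma (space M) {X j -` A \<inter> space M | j A. j \<in> T k \<and> A \<in> sets borel})
             (\<lambda>\<omega>. \<Prod>i\<in>G k. g i (X i \<omega>) (X (i @ [False]) \<omega>) (X (i @ [True]) \<omega>)) \<omega>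
           = (\<Prod>i\<in>G k. \<integral>yz. g i (X i \<omega>) (fst yz) (snd yz) \<partial>(P (X i \<omega>)))))"

definition scaled_log_prob :: "'w measure \<Rightarrow> (nat \<Rightarrow> 'w \<Rightarrow> real) \<Rightarrow> (nat \<Rightarrow> real) \<Rightarrow> real set \<Rightarrow> nat \<Rightarrow> ereal" where
  "scaled_log_prob M Z s A n =
     (let p = measure M {\<omega> \<in> space M. Z n \<omega> \<in> A}
      in if p = 0 then - \<infinity> else ereal (ln p / s n))"

definition MDP :: "'w measure \<Rightarrow> (nat \<Rightarrow> 'w \<Rightarrow> real) \<Rightarrow> (nat \<Rightarrow> real) \<Rightarrow> (real \<Rightarrow> real) \<Rightarrow> bool" where
  "MDP M Z s I \<longleftrightarrow>
     (\<forall>A \<in> sets (borel :: real measure).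
        - (INF y\<in>interior A. ereal (I y)) \<le> liminf (scaled_log_prob M Z s A) \<and>
        liminf (scaled_log_prob M Z s A) \<le> limsup (scaled_log_prob M Z s A) \<and>
        limsup (scaled_log_prob M Z s A) \<le> - (INF y\<in>closure A. ereal (I y)))"

end

theory Submission
  imports Defs
begin

text \<open>
  By Gaertner--Ellis it suffices that \<open>b\<^sub>n\<close> to the power \<open>-2\<close> times the logarithm of the Laplace transform of
  \<open>b\<^sub>n N\<^sub>n\<close> at \<open>r\<close> tends to \<open>r\<^sup>2 \<sigma>\<^sup>2 / 2\<close>. The branching property computes this transform exactly by the
  backward recursion \<open>v\<^sub>l = \<phi>\<^sub>l + ln P(exp (v\<^sub>l\<^sub>-\<^sub>1 \<oplus> v\<^sub>l\<^sub>-\<^sub>1))\<close>. The scaled functions are uniformly small, so one step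
  of the recursion is \<open>\<phi>\<^sub>l + 2 Q v\<^sub>l\<^sub>-\<^sub>1\<close> plus half the conditional variance of \<open>v\<^sub>l\<^sub>-\<^sub>1 \<oplus> v\<^sub>l\<^sub>-\<^sub>1\<close>, up to a small
  relative error. The part of \<open>v\<^sub>l\<close> other than \<open>\<phi>\<^sub>l\<close> oscillates by at most a constant times
  \<open>A q \<theta>\<^sup>l\<close> for any \<open>\<theta>\<close> slightly above \<open>max 1 (2 \<alpha>)\<close>; the condition on \<open>\<alpha>\<close> and \<open>\<gamma>\<close> says that such a \<open>\<theta>\<close> can be
  chosen with \<open>q\<^sup>2 \<theta>\<^sup>n\<close> tending to 0. Only the variances of the \<open>\<phi>\<^sub>l\<close> survive, and they sum to \<open>\<sigma>\<^sup>2\<close>.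
\<close>

section \<open>Second-order estimates\<close>

text \<open>The obstacle is the factor 2 per generation: an error made at height l reaches the root
  multiplied by about 2^(n-l), and the total must be small against \<open>A^2 * 2^n\<close>, which
  equals \<open>r^2 * b_n^2\<close>. An error per vertex is thus affordable only if it is small
  against \<open>A^2\<close>, while the weights themselves have supremum of order \<eta> = A / q,
  far larger than A. Hence every remainder is kept relative to a variance. Adding a constant to v
  adds twice that constant one step later, so the mean may grow like 2^l; only the oscillation
  enters the nonlinear part. It obeys a recursion with factor 2 * \<alpha> and forcing of order
  \<open>A * q\<close>, because Q maps the weights to functions that small. An oscillation
  \<open>A * q * \<theta>^l\<close> then gives cross terms \<open>A^2 * q * \<theta>^l\<close>,
  summable against 2^(-l) as \<theta> < 2, and squares \<open>A^2 * q^2 * \<theta>^(2*l)\<close>, at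
  most \<open>A^2 * (q^2 * \<theta>^n) * \<theta>^l\<close>.\<close>

lemma exp_quadratic_remainder:
  fixes y e :: real
  assumes "\<bar>y\<bar> \<le> e" "e \<le> 1"
  shows "\<bar>exp y - (1 + y + y\<^sup>2 / 2)\<bar> \<le> e * y\<^sup>2 / 2"
proof -
  obtain t where t: "\<bar>t\<bar> \<le> \<bar>y\<bar>"
    and eq: "exp y = (\<Sum>m<3. y ^ m / fact m) + exp t / fact 3 * y ^ 3"
    using Maclaurin_exp_le[of y 3] by blast
  have "exp t \<le> exp 1" using t assms by simp
  also have "\<dots> \<le> 3" using exp_le by simp
  finally have t3: "exp t \<le> 3" .
  have "exp y - (1 + y + y\<^sup>2 / 2) = exp t / 6 * y ^ 3"
    unfolding eq by (simp add: eval_nat_numeral field_simps)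
  then have "\<bar>exp y - (1 + y + y\<^sup>2 / 2)\<bar> = \<bar>exp t / 6 * y ^ 3\<bar>"
    by (rule arg_cong)
  also have "\<dots> = exp t / 6 * (\<bar>y\<bar> * y\<^sup>2)"
    by (simp add: abs_mult power3_eq_cube power2_eq_square)
  \<comment> \<open>One factor |y| is given up as e, so that the error is relative to the square and
    integrates to a multiple of the variance.\<close>
  also have "\<dots> \<le> 3 / 6 * (e * y\<^sup>2)"
    using t3 assms by (intro mult_mono) auto
  finally show ?thesis by simp
qed

text \<open>The linear Taylor term integrates to 0, which encloses the transform between
  \<open>1 + (1 - e) / 2 * V\<close> and \<open>1 + (1 + e) / 2 * V\<close>. The error is
  proportional to V because it will be accumulated over the whole tree.\<close>

lemma (in prob_space) ln_mgf_quadratic: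
  fixes D :: "'a \<Rightarrow> real"
  assumes [measurable]: "D \<in> borel_measurable M" and bound: "\<And>x. \<bar>D x\<bar> \<le> e" and "e \<le> 1"
    and mean: "expectation D = 0"
  defines "V \<equiv> expectation (\<lambda>x. (D x)\<^sup>2)"
  shows "\<bar>ln (expectation (\<lambda>x. exp (D x))) - V / 2\<bar> \<le> e * V"
proof -
  obtain x0 where "x0 \<in> space M" using not_empty by blast
  have e0: "0 \<le> e" using bound[of x0] by linarith
  have sq: "(D x)\<^sup>2 \<le> e\<^sup>2" for x
    using power_mono[OF bound[of x], of 2] by simp
  have int1: "integrable M D"
    by (rule integrable_const_bound[where B = e]) (auto simp: bound)
  have int2: "integrable M (\<lambda>x. (D x)\<^sup>2)"
    by (rule integrable_const_bound[where B = "e\<^sup>2"]) (auto simp: sq)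
  have De: "D x \<le> e" for x using bound[of x] by linarith
  have int3: "integrable M (\<lambda>x. exp (D x))"
    by (rule integrable_const_bound[where B = "exp e"]) (auto simp: De)
  have V0: "0 \<le> V" unfolding V_def by simp
  have "V \<le> expectation (\<lambda>_. e\<^sup>2)"
    unfolding V_def by (rule integral_mono[OF int2]) (auto simp: sq)
  then have Ve: "V \<le> e\<^sup>2" by (simp add: prob_space)
  have rem: "\<bar>exp (D x) - (1 + D x + (D x)\<^sup>2 / 2)\<bar> \<le> e * (D x)\<^sup>2 / 2" for x
    using exp_quadratic_remainder bound \<open>e \<le> 1\<close> by blast
  have "expectation (\<lambda>x. exp (D x)) \<le> expectation (\<lambda>x. 1 + D x + (1 + e) / 2 * (D x)\<^sup>2)"
  proof (rule integral_mono)
    show "exp (D x) \<le> 1 + D x + (1 + e) / 2 * (D x)\<^sup>2" for x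
    proof -
      have "(1 + e) / 2 * (D x)\<^sup>2 = (D x)\<^sup>2 / 2 + e * (D x)\<^sup>2 / 2" by (simp add: field_simps)
      then show ?thesis using rem[of x] by linarith
    qed
  qed (use int1 int2 int3 in auto)
  also have "\<dots> = 1 + (1 + e) / 2 * V"
    using int1 int2 mean by (simp add: V_def prob_space)
  finally have up: "expectation (\<lambda>x. exp (D x)) \<le> 1 + (1 + e) / 2 * V" .
  have "expectation (\<lambda>x. 1 + D x + (1 - e) / 2 * (D x)\<^sup>2) \<le> expectation (\<lambda>x. exp (D x))"
  proof (rule integral_mono)
    show "1 + D x + (1 - e) / 2 * (D x)\<^sup>2 \<le> exp (D x)" for x
    proof -
      have "(1 - e) / 2 * (D x)\<^sup>2 = (D x)\<^sup>2 / 2 - e * (D x)\<^sup>2 / 2" by (simp add: field_simps)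
      then show ?thesis using rem[of x] by linarith
    qed
  qed (use int1 int2 int3 in auto)
  moreover have "expectation (\<lambda>x. 1 + D x + (1 - e) / 2 * (D x)\<^sup>2) = 1 + (1 - e) / 2 * V"
    using int1 int2 mean by (simp add: V_def prob_space)
  ultimately have lo: "1 + (1 - e) / 2 * V \<le> expectation (\<lambda>x. exp (D x))" by simp
  \<comment> \<open>On the lower side s itself loses \<open>e * V / 2\<close>, and the term
    \<open>s^2\<close> in the bound for the logarithm costs the other \<open>e * V / 2\<close>,
    since V is at most \<open>e^2\<close> and hence at most e.\<close>
  define s where "s = (1 - e) / 2 * V"
  have s0: "0 \<le> s" using V0 \<open>e \<le> 1\<close> by (simp add: s_def)
  have V1: "V \<le> e" using Ve e0 \<open>e \<le> 1\<close> mult_left_mono[of e 1 e] by (simp add: power2_eq_square)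
  have sV: "s \<le> V / 2" unfolding s_def using V0 e0 by (simp add: algebra_simps)
  have s1: "s \<le> 1" using sV V1 \<open>e \<le> 1\<close> by linarith
  have ss: "s\<^sup>2 \<le> e * V / 2"
  proof -
    have "s * s \<le> V / 2 * e" using sV V1 s0 V0 e0 by (intro mult_mono) auto
    then show ?thesis by (simp add: power2_eq_square field_simps)
  qed
  have "ln (expectation (\<lambda>x. exp (D x))) \<le> (1 + e) / 2 * V"
  proof -
    have "0 < expectation (\<lambda>x. exp (D x))" using lo s0 by (simp add: s_def)
    then have "ln (expectation (\<lambda>x. exp (D x))) \<le> ln (1 + (1 + e) / 2 * V)" using up by simp
    also have "\<dots> \<le> (1 + e) / 2 * V" by (rule ln_add_one_self_le_self) (use V0 e0 in simp)
    finally show ?thesis .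
  qed
  moreover have "s - s\<^sup>2 \<le> ln (expectation (\<lambda>x. exp (D x)))"
  proof -
    have "s - s\<^sup>2 \<le> ln (1 + s)" by (rule ln_one_plus_pos_lower_bound) (use s0 s1 in auto)
    also have "\<dots> \<le> ln (expectation (\<lambda>x. exp (D x)))" using lo s0 by (simp add: s_def)
    finally show ?thesis .
  qed
  moreover have "0 \<le> e * V" using e0 V0 by simp
  moreover have "(1 + e) / 2 * V = V / 2 + e * V / 2" "s = V / 2 - e * V / 2"
    by (simp_all add: s_def field_simps)
  ultimately show ?thesis
    using ss by linarith
qed

text \<open>The cross term is handled by Young's inequality with weight s, a substitute for
  Cauchy-Schwarz. The bound sees the L2 size s of A and not its supremum, which in the application
  is larger by a factor of order 1 / q.\<close>

lemma (in prob_space) second_moment_perturbation: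
  fixes A B :: "'a \<Rightarrow> real"
  assumes [measurable]: "A \<in> borel_measurable M" "B \<in> borel_measurable M"
    and A: "\<And>x. \<bar>A x\<bar> \<le> K" and B: "\<And>x. \<bar>B x\<bar> \<le> \<beta>"
    and s: "0 < s" "expectation (\<lambda>x. (A x)\<^sup>2) \<le> s\<^sup>2"
  shows "\<bar>expectation (\<lambda>x. (A x + B x)\<^sup>2) - expectation (\<lambda>x. (A x)\<^sup>2)\<bar> \<le> 2 * s * \<beta> + \<beta>\<^sup>2"
proof -
  obtain x0 where "x0 \<in> space M" using not_empty by blast
  have \<beta>0: "0 \<le> \<beta>" using B[of x0] by linarith
  have A2: "(A x)\<^sup>2 \<le> K\<^sup>2" for x
    using power_mono[OF A[of x], of 2] by simp
  have B2: "(B x)\<^sup>2 \<le> \<beta>\<^sup>2" for x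
    using power_mono[OF B[of x], of 2] by simp
  have AB: "\<bar>A x * B x\<bar> \<le> K * \<beta>" for x
    unfolding abs_mult by (rule mult_mono) (use A[of x] B[of x] in auto)
  have iA: "integrable M (\<lambda>x. (A x)\<^sup>2)"
    by (rule integrable_const_bound[where B = "K\<^sup>2"]) (auto simp: A2)
  have iB: "integrable M (\<lambda>x. (B x)\<^sup>2)"
    by (rule integrable_const_bound[where B = "\<beta>\<^sup>2"]) (auto simp: B2)
  have iAB: "integrable M (\<lambda>x. A x * B x)"
    by (rule integrable_const_bound[where B = "K * \<beta>"]) (use AB in auto)
  have "expectation (\<lambda>x. (A x + B x)\<^sup>2) =
      expectation (\<lambda>x. (A x)\<^sup>2 + 2 * (A x * B x) + (B x)\<^sup>2)"
    by (simp add: power2_sum algebra_simps)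
  also have "\<dots> = expectation (\<lambda>x. (A x)\<^sup>2) + 2 * expectation (\<lambda>x. A x * B x) + expectation (\<lambda>x. (B x)\<^sup>2)"
    using iA iB iAB by simp
  finally have eq: "expectation (\<lambda>x. (A x + B x)\<^sup>2) - expectation (\<lambda>x. (A x)\<^sup>2) =
      2 * expectation (\<lambda>x. A x * B x) + expectation (\<lambda>x. (B x)\<^sup>2)" by simp
  have pt: "\<bar>A x * B x\<bar> \<le> \<beta> / (2 * s) * (A x)\<^sup>2 + \<beta> * s / 2" for x
  proof -
    have "0 \<le> (\<bar>A x\<bar> - s)\<^sup>2" by simp
    then have "\<bar>A x\<bar> * (2 * s) \<le> (A x)\<^sup>2 + s\<^sup>2"
      by (simp add: power2_diff algebra_simps)
    then have "\<bar>A x\<bar> \<le> ((A x)\<^sup>2 + s\<^sup>2) / (2 * s)"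
      using s(1) by (simp add: pos_le_divide_eq)
    also have "\<dots> = (A x)\<^sup>2 / (2 * s) + s / 2"
      using s(1) by (simp add: add_divide_distrib power2_eq_square)
    finally have "\<bar>A x\<bar> \<le> (A x)\<^sup>2 / (2 * s) + s / 2" .
    then have "\<bar>A x\<bar> * \<bar>B x\<bar> \<le> ((A x)\<^sup>2 / (2 * s) + s / 2) * \<beta>"
      using B[of x] by (intro mult_mono) auto
    then show ?thesis by (simp add: abs_mult algebra_simps)
  qed
  have "\<bar>expectation (\<lambda>x. A x * B x)\<bar> \<le> expectation (\<lambda>x. \<bar>A x * B x\<bar>)"
    by (rule integral_abs_bound)
  also have "\<dots> \<le> expectation (\<lambda>x. \<beta> / (2 * s) * (A x)\<^sup>2 + \<beta> * s / 2)"
    by (rule integral_mono) (use iA iAB pt in auto)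
  also have "\<dots> = \<beta> / (2 * s) * expectation (\<lambda>x. (A x)\<^sup>2) + \<beta> * s / 2"
    using iA by (simp add: prob_space)
  also have "\<dots> \<le> \<beta> / (2 * s) * s\<^sup>2 + \<beta> * s / 2"
    using s \<beta>0 by (intro add_right_mono mult_left_mono) auto
  also have "\<dots> = s * \<beta>" using s(1) by (simp add: power2_eq_square field_simps)
  finally have 1: "\<bar>expectation (\<lambda>x. A x * B x)\<bar> \<le> s * \<beta>" .
  have "expectation (\<lambda>x. (B x)\<^sup>2) \<le> expectation (\<lambda>x. \<beta>\<^sup>2)"
    by (rule integral_mono) (use iB B2 in auto)
  then have 2: "expectation (\<lambda>x. (B x)\<^sup>2) \<le> \<beta>\<^sup>2" by (simp add: prob_space)
  have 3: "0 \<le> expectation (\<lambda>x. (B x)\<^sup>2)" by simp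
  show ?thesis unfolding eq using 1 2 3 by linarith
qed

lemma (in prob_space) chernoff_upper:
  assumes [measurable]: "Y \<in> borel_measurable M" and b: "\<And>x. \<bar>Y x\<bar> \<le> B"
    and sub: "\<And>x. x \<in> S \<Longrightarrow> c \<le> t * Y x" and [measurable]: "S \<in> events"
  shows "prob S \<le> exp (- c) * expectation (\<lambda>x. exp (t * Y x))"
proof -
  have tb: "t * Y x \<le> \<bar>t\<bar> * B" for x
    by (rule order_trans[OF abs_ge_self]) (use b[of x] in \<open>auto simp: abs_mult intro: mult_left_mono\<close>)
  have i: "integrable M (\<lambda>x. exp (t * Y x))"
    by (rule integrable_const_bound[where B = "exp (\<bar>t\<bar> * B)"]) (auto simp: tb)
  have iS: "integrable M (indicator S :: _ \<Rightarrow> real)"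
    by (rule integrable_const_bound[where B = 1]) auto
  have "prob S = expectation (indicator S)" by simp
  also have "\<dots> \<le> expectation (\<lambda>x. exp (- c) * exp (t * Y x))"
  proof (rule integral_mono)
    fix x show "indicator S x \<le> exp (- c) * exp (t * Y x)"
      using sub[of x] by (auto simp: indicator_def mult_exp_exp)
  qed (use i iS in auto)
  finally show ?thesis using i by simp
qed

section \<open>Large deviations with a quadratic limit\<close>

text \<open>The lower bound needs no change of measure: off a neighbourhood of \<open>y\<close>, the exponential with slope
  \<open>t\<close> is dominated pointwise by those with slopes \<open>t + u\<close> and \<open>t - u\<close>.\<close>

locale quadratic_log_laplace = prob_space M for M :: "'w measure" +
  fixes Z :: "nat \<Rightarrow> 'w \<Rightarrow> real" and s :: "nat \<Rightarrow> real" and \<sigma>2 :: real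
  assumes Z_meas [measurable]: "Z n \<in> borel_measurable M"
    and Z_bdd: "\<exists>B. \<forall>\<omega>. \<bar>Z n \<omega>\<bar> \<le> B"
    and s_pos: "0 < s n"
    and s_inf: "filterlim s at_top sequentially"
    and sigma_pos: "0 < \<sigma>2"
    and log_laplace: "(\<lambda>n. ln (expectation (\<lambda>\<omega>. exp (t * s n * Z n \<omega>))) / s n) \<longlonglongrightarrow> t\<^sup>2 * \<sigma>2 / 2"
begin

definition L :: "real \<Rightarrow> nat \<Rightarrow> real" where
  "L t n = expectation (\<lambda>\<omega>. exp (t * s n * Z n \<omega>))"

lemma exp_integrable: "integrable M (\<lambda>\<omega>. exp (t * Z n \<omega>))"
proof -
  obtain B where B: "\<And>\<omega>. \<bar>Z n \<omega>\<bar> \<le> B" using Z_bdd by blast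
  have "t * Z n \<omega> \<le> \<bar>t\<bar> * B" for \<omega>
    by (rule order_trans[OF abs_ge_self]) (use B[of \<omega>] in \<open>auto simp: abs_mult intro: mult_left_mono\<close>)
  then show ?thesis
    by (intro integrable_const_bound[where B = "exp (\<bar>t\<bar> * B)"]) auto
qed

lemma L_pos: "0 < L t n"
proof -
  obtain B where B: "\<And>\<omega>. \<bar>Z n \<omega>\<bar> \<le> B" using Z_bdd by blast
  have "- (\<bar>t * s n\<bar> * B) \<le> t * s n * Z n \<omega>" for \<omega>
    using mult_left_mono[OF B[of \<omega>], of "\<bar>t * s n\<bar>"] by (simp add: abs_mult[symmetric])
  then have "expectation (\<lambda>\<omega>. exp (- (\<bar>t * s n\<bar> * B))) \<le> L t n"
    unfolding L_def by (intro integral_mono exp_integrable) auto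
  then show ?thesis by (simp add: prob_space less_le_trans[OF exp_gt_zero])
qed

lemma L_upper:
  assumes "0 < e"
  shows "\<forall>\<^sub>F n in sequentially. L t n \<le> exp (s n * (t\<^sup>2 * \<sigma>2 / 2 + e))"
proof -
  have "\<forall>\<^sub>F n in sequentially. ln (L t n) / s n < t\<^sup>2 * \<sigma>2 / 2 + e"
    using order_tendstoD(2)[OF log_laplace[of t]] assms by (simp add: L_def)
  then show ?thesis
  proof eventually_elim
    case (elim n)
    then have "ln (L t n) \<le> s n * (t\<^sup>2 * \<sigma>2 / 2 + e)"
      using s_pos[of n] by (simp add: pos_divide_less_eq mult.commute)
    then have "exp (ln (L t n)) \<le> exp (s n * (t\<^sup>2 * \<sigma>2 / 2 + e))" by simp
    then show ?case using L_pos[of t n] by simp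
  qed
qed

lemma L_lower:
  assumes "0 < e"
  shows "\<forall>\<^sub>F n in sequentially. exp (s n * (t\<^sup>2 * \<sigma>2 / 2 - e)) \<le> L t n"
proof -
  have "\<forall>\<^sub>F n in sequentially. t\<^sup>2 * \<sigma>2 / 2 - e < ln (L t n) / s n"
    using order_tendstoD(1)[OF log_laplace[of t]] assms by (simp add: L_def)
  then show ?thesis
  proof eventually_elim
    case (elim n)
    then have "s n * (t\<^sup>2 * \<sigma>2 / 2 - e) \<le> ln (L t n)"
      using s_pos[of n] by (simp add: pos_less_divide_eq mult.commute)
    then show ?case using L_pos[of t n] by (simp add: ln_ge_iff)
  qed
qed

text \<open>The fixed factors 2 and 4 lost to unions and sums cost only an arbitrarily small e in
  the exponent.\<close>

lemma exp_s_le: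
  assumes "0 < e"
  shows "\<forall>\<^sub>F n in sequentially. c \<le> exp (s n * e)"
proof -
  have "filterlim (\<lambda>n. s n * e) at_top sequentially"
    using filterlim_tendsto_pos_mult_at_top[OF tendsto_const assms s_inf] by (simp add: mult.commute)
  then have "filterlim (\<lambda>n. exp (s n * e)) at_top sequentially"
    by (rule filterlim_compose[OF exp_at_top])
  then show ?thesis by (simp add: filterlim_at_top)
qed

lemma tail_bound:
  assumes "0 \<le> r" "0 < e"
  shows "\<forall>\<^sub>F n in sequentially.
    prob {\<omega> \<in> space M. r \<le> \<bar>Z n \<omega>\<bar>} \<le> exp (s n * (- r\<^sup>2 / (2 * \<sigma>2) + e))"
proof -
  \<comment> \<open>Maximiser of \<open>t * r - t^2 * \<sigma>2 / 2\<close>, with value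
    \<open>r^2 / (2 * \<sigma>2)\<close>.\<close>
  define t where "t = r / \<sigma>2"
  have t0: "0 \<le> t" using assms sigma_pos by (simp add: t_def)
  have e4: "0 < e / 2" using assms by simp
  show ?thesis
    using L_upper[OF e4, of t] L_upper[OF e4, of "-t"] exp_s_le[OF e4, of 2]
  proof eventually_elim
    case (elim n)
    obtain B where B: "\<And>\<omega>. \<bar>Z n \<omega>\<bar> \<le> B" using Z_bdd by blast
    have ev: "prob {\<omega> \<in> space M. r \<le> c * Z n \<omega>} \<le> exp (- (t * s n * r)) * L (c * t) n" if "\<bar>c\<bar> = 1" for c
    proof -
      have "prob {\<omega> \<in> space M. r \<le> c * Z n \<omega>}
        \<le> exp (- (t * s n * r)) * expectation (\<lambda>\<omega>. exp (c * t * s n * Z n \<omega>))"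
      proof (rule chernoff_upper[OF _ B])
        fix \<omega> assume "\<omega> \<in> {\<omega> \<in> space M. r \<le> c * Z n \<omega>}"
        then have "t * s n * r \<le> t * s n * (c * Z n \<omega>)"
          using t0 s_pos[of n] by (intro mult_left_mono) auto
        then show "t * s n * r \<le> c * t * s n * Z n \<omega>" by (simp add: mult.commute mult.left_commute)
      qed measurable
      then show ?thesis by (simp add: L_def)
    qed
    have "{\<omega> \<in> space M. r \<le> \<bar>Z n \<omega>\<bar>} = {\<omega> \<in> space M. r \<le> 1 * Z n \<omega>} \<union> {\<omega> \<in> space M. r \<le> - 1 * Z n \<omega>}"
      by auto
    then have "prob {\<omega> \<in> space M. r \<le> \<bar>Z n \<omega>\<bar>}
      \<le> prob {\<omega> \<in> space M. r \<le> 1 * Z n \<omega>} + prob {\<omega> \<in> space M. r \<le> - 1 * Z n \<omega>}"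
      by (simp only:) (rule measure_subadditive, auto)
    also have "\<dots> \<le> exp (- (t * s n * r)) * L t n + exp (- (t * s n * r)) * L (- t) n"
      using ev[of 1] ev[of "-1"] by (intro add_mono) auto
    also have "\<dots> \<le> 2 * (exp (- (t * s n * r)) * exp (s n * (t\<^sup>2 * \<sigma>2 / 2 + e / 2)))"
      using elim(1,2) by (simp add: mult_left_mono flip: distrib_left)
    also have "\<dots> \<le> exp (s n * (e / 2)) * (exp (- (t * s n * r)) * exp (s n * (t\<^sup>2 * \<sigma>2 / 2 + e / 2)))"
      using elim(3) by (intro mult_right_mono) auto
    also have "\<dots> = exp (s n * (- r\<^sup>2 / (2 * \<sigma>2) + e))"
    proof -
      have "t\<^sup>2 * \<sigma>2 = r\<^sup>2 / \<sigma>2" "t * s n * r = s n * (r\<^sup>2 / \<sigma>2)"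
        using sigma_pos by (simp_all add: t_def power2_eq_square)
      then have "s n * (e / 2) + (- (t * s n * r) + s n * (t\<^sup>2 * \<sigma>2 / 2 + e / 2)) = s n * (- r\<^sup>2 / (2 * \<sigma>2) + e)"
        by (simp add: algebra_simps)
      then show ?thesis by (simp add: mult_exp_exp)
    qed
    finally show ?case .
  qed
qed

lemma ball_lower_bound:
  assumes "0 < e" "0 < \<delta>" and small: "\<bar>y\<bar> / \<sigma>2 * \<delta> \<le> e / 4"
  shows "\<forall>\<^sub>F n in sequentially. exp (s n * (- y\<^sup>2 / (2 * \<sigma>2) - e)) \<le> prob {\<omega> \<in> space M. \<bar>Z n \<omega> - y\<bar> < \<delta>}"
proof -
  \<comment> \<open>t is the optimal slope for y and u the optimal shift for \<delta>: each tail
    drops below the scale of \<open>L t\<close> by the exponent 4 * \<rho>. One \<rho> pays for the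
    upper estimate of L, one for the factor 4, and \<open>\<rho>'\<close> for the lower estimate of
    \<open>L t\<close>. This last loss stays in the final bound, so \<open>\<rho>'\<close> is also
    capped by e / 4.\<close>
  define t where "t = y / \<sigma>2"
  define u where "u = \<delta> / \<sigma>2"
  define \<rho> where "\<rho> = \<delta>\<^sup>2 / (8 * \<sigma>2)"
  define \<rho>' where "\<rho>' = min \<rho> (e / 4)"
  have u0: "0 < u" and r0: "0 < \<rho>" and r'0: "0 < \<rho>'" and e4: "0 < e / 4"
    using assms sigma_pos by (auto simp: u_def \<rho>_def \<rho>'_def)
  show ?thesis
    using L_upper[OF r0, of "t + u"] L_upper[OF r0, of "t - u"] L_lower[OF r'0, of t]
      exp_s_le[OF r0, of 4] exp_s_le[OF e4, of 2]
  proof eventually_elim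
    case (elim n)
    define A where "A = {\<omega> \<in> space M. \<bar>Z n \<omega> - y\<bar> < \<delta>}"
    have [measurable]: "A \<in> events" unfolding A_def by measurable
    have iA: "integrable M (indicator A :: _ \<Rightarrow> real)"
      by (rule integrable_const_bound[where B = 1]) auto
    define m where "m = exp (s n * (t * y + e / 4))"
    define c1 where "c1 = exp (- (u * s n * (y + \<delta>)))"
    define c2 where "c2 = exp (u * s n * (y - \<delta>))"
    have pt: "exp (t * s n * Z n \<omega>) \<le> m * indicator A \<omega> + c1 * exp ((t + u) * s n * Z n \<omega>)
        + c2 * exp ((t - u) * s n * Z n \<omega>)" if \<omega>: "\<omega> \<in> space M" for \<omega>
    proof -
      have us: "0 \<le> u * s n" using u0 s_pos[of n] by simp
      consider "\<bar>Z n \<omega> - y\<bar> < \<delta>" | "y + \<delta> \<le> Z n \<omega>" | "Z n \<omega> \<le> y - \<delta>" by linarith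
      then show ?thesis
      proof cases
        case 1
        have "t * Z n \<omega> = t * y + t * (Z n \<omega> - y)" by (simp add: algebra_simps)
        also have "\<dots> \<le> t * y + \<bar>t\<bar> * \<bar>Z n \<omega> - y\<bar>"
          by (intro add_left_mono) (simp add: abs_ge_self flip: abs_mult)
        also have "\<dots> \<le> t * y + \<bar>t\<bar> * \<delta>"
          using 1 by (intro add_left_mono mult_left_mono) auto
        also have "\<dots> \<le> t * y + e / 4" using small sigma_pos by (simp add: t_def)
        finally have "s n * (t * Z n \<omega>) \<le> s n * (t * y + e / 4)"
          using s_pos[of n] by (intro mult_left_mono) auto
        then have "exp (t * s n * Z n \<omega>) \<le> m * indicator A \<omega>"
          using 1 \<omega> by (simp add: m_def A_def mult_ac)
        then show ?thesis by (simp add: c1_def c2_def add_increasing2)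
      next
        case 2
        have "u * s n * (y + \<delta>) \<le> u * s n * Z n \<omega>" by (rule mult_left_mono[OF 2 us])
        then have "exp (t * s n * Z n \<omega>) \<le> c1 * exp ((t + u) * s n * Z n \<omega>)"
          by (simp add: c1_def mult_exp_exp algebra_simps)
        moreover have "0 \<le> m * indicator A \<omega>" by (simp add: m_def)
        ultimately show ?thesis by (simp add: c2_def add_increasing add_increasing2)
      next
        case 3
        have "u * s n * Z n \<omega> \<le> u * s n * (y - \<delta>)" by (rule mult_left_mono[OF 3 us])
        then have "exp (t * s n * Z n \<omega>) \<le> c2 * exp ((t - u) * s n * Z n \<omega>)"
          by (simp add: c2_def mult_exp_exp algebra_simps)
        moreover have "0 \<le> m * indicator A \<omega>" by (simp add: m_def)
        ultimately show ?thesis by (simp add: c1_def add_increasing add_increasing2)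
      qed
    qed
    have "L t n \<le> expectation (\<lambda>\<omega>. m * indicator A \<omega> + c1 * exp ((t + u) * s n * Z n \<omega>)
        + c2 * exp ((t - u) * s n * Z n \<omega>))"
      unfolding L_def by (rule integral_mono) (use pt exp_integrable iA in auto)
    also have "\<dots> = m * prob A + c1 * L (t + u) n + c2 * L (t - u) n"
      unfolding L_def using exp_integrable iA by simp
    finally have main: "L t n \<le> m * prob A + c1 * L (t + u) n + c2 * L (t - u) n" .
    \<comment> \<open>E is a lower bound for \<open>L t n\<close>; each tail takes at most a quarter
      of it, so at least half is left for the ball.\<close>
    define E where "E = exp (s n * (t\<^sup>2 * \<sigma>2 / 2 - \<rho>'))"
    have "\<rho>' \<le> \<rho>" by (simp add: \<rho>'_def)
    have tail: "4 * (exp (- (s n * (u * (v * y + \<delta>)))) * exp (s n * ((t + v * u)\<^sup>2 * \<sigma>2 / 2 + \<rho>))) \<le> E"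
      if "\<bar>v\<bar> = 1" for v
    proof -
      have v2: "v\<^sup>2 = 1" using that by (metis power2_abs power_one)
      have "(t + v * u)\<^sup>2 * \<sigma>2 = t\<^sup>2 * \<sigma>2 + 2 * v * u * (t * \<sigma>2) + v\<^sup>2 * (u * (u * \<sigma>2))"
        by (simp add: power2_eq_square algebra_simps)
      moreover have "t * \<sigma>2 = y" "u * \<sigma>2 = \<delta>" using sigma_pos by (simp_all add: t_def u_def)
      ultimately have "(t + v * u)\<^sup>2 * \<sigma>2 = t\<^sup>2 * \<sigma>2 + 2 * v * u * y + u * \<delta>" using v2 by simp
      moreover have "u * \<delta> = 8 * \<rho>" by (simp add: u_def \<rho>_def power2_eq_square)
      moreover have "u * (v * y + \<delta>) = v * u * y + u * \<delta>" by (simp add: algebra_simps)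
      ultimately have "\<rho> - u * (v * y + \<delta>) + ((t + v * u)\<^sup>2 * \<sigma>2 / 2 + \<rho>) \<le> t\<^sup>2 * \<sigma>2 / 2 - \<rho>'"
        using r0 \<open>\<rho>' \<le> \<rho>\<close> by linarith
      then have "s n * (\<rho> - u * (v * y + \<delta>) + ((t + v * u)\<^sup>2 * \<sigma>2 / 2 + \<rho>)) \<le> s n * (t\<^sup>2 * \<sigma>2 / 2 - \<rho>')"
        using s_pos[of n] by (intro mult_left_mono) auto
      then have "exp (s n * \<rho>) * (exp (- (s n * (u * (v * y + \<delta>)))) * exp (s n * ((t + v * u)\<^sup>2 * \<sigma>2 / 2 + \<rho>))) \<le> E"
        by (simp add: E_def mult_exp_exp algebra_simps)
      moreover have "4 * (exp (- (s n * (u * (v * y + \<delta>)))) * exp (s n * ((t + v * u)\<^sup>2 * \<sigma>2 / 2 + \<rho>)))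
         \<le> exp (s n * \<rho>) * (exp (- (s n * (u * (v * y + \<delta>)))) * exp (s n * ((t + v * u)\<^sup>2 * \<sigma>2 / 2 + \<rho>)))"
        using elim(4) by (intro mult_right_mono) auto
      ultimately show ?thesis by linarith
    qed
    have "c1 * L (t + u) n \<le> E / 4"
    proof -
      have "c1 * L (t + u) n \<le> c1 * exp (s n * ((t + u)\<^sup>2 * \<sigma>2 / 2 + \<rho>))"
        using elim(1) by (intro mult_left_mono) (auto simp: c1_def)
      moreover have "exp (- (s n * (u * (y + \<delta>)))) = c1" by (simp add: c1_def mult_ac)
      then have "4 * (c1 * exp (s n * ((t + u)\<^sup>2 * \<sigma>2 / 2 + \<rho>))) \<le> E" using tail[of 1] by simp
      ultimately show ?thesis by linarith
    qed
    moreover have "c2 * L (t - u) n \<le> E / 4"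
    proof -
      have "c2 * L (t - u) n \<le> c2 * exp (s n * ((t - u)\<^sup>2 * \<sigma>2 / 2 + \<rho>))"
        using elim(2) by (intro mult_left_mono) (auto simp: c2_def)
      moreover have "exp (- (s n * (u * (- 1 * y + \<delta>)))) = c2" by (simp add: c2_def algebra_simps)
      then have "4 * (c2 * exp (s n * ((t + - 1 * u)\<^sup>2 * \<sigma>2 / 2 + \<rho>))) \<le> E"
        using tail[of "-1"] by simp
      then have "4 * (c2 * exp (s n * ((t - u)\<^sup>2 * \<sigma>2 / 2 + \<rho>))) \<le> E" by simp
      ultimately show ?thesis by linarith
    qed
    moreover have "E \<le> L t n" using elim(3) by (simp add: E_def)
    ultimately have "E \<le> exp (s n * (e / 4)) * (m * prob A)"
    proof -
      assume "c1 * L (t + u) n \<le> E / 4" "c2 * L (t - u) n \<le> E / 4" "E \<le> L t n"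
      then have "E \<le> 2 * (m * prob A)" using main by linarith
      also have "\<dots> \<le> exp (s n * (e / 4)) * (m * prob A)"
        using elim(5) by (intro mult_right_mono) (auto simp: m_def)
      finally show ?thesis .
    qed
    then have "E \<le> exp (s n * (e / 4) + s n * (t * y + e / 4)) * prob A"
      by (simp add: m_def mult_exp_exp flip: mult.assoc)
    then have "exp (- (s n * (e / 4) + s n * (t * y + e / 4))) * E \<le> prob A"
      by (simp add: exp_minus field_simps)
    moreover have "exp (s n * (- y\<^sup>2 / (2 * \<sigma>2) - e)) \<le> exp (- (s n * (e / 4) + s n * (t * y + e / 4))) * E"
    proof -
      have "t\<^sup>2 * \<sigma>2 = y\<^sup>2 / \<sigma>2" "t * y = y\<^sup>2 / \<sigma>2"
        using sigma_pos by (simp_all add: t_def power2_eq_square)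
      then have "- y\<^sup>2 / (2 * \<sigma>2) - e \<le> - (e / 4 + (t * y + e / 4)) + (t\<^sup>2 * \<sigma>2 / 2 - \<rho>')"
        using assms by (simp add: \<rho>'_def min_def field_simps)
      then have "s n * (- y\<^sup>2 / (2 * \<sigma>2) - e) \<le> s n * (- (e / 4 + (t * y + e / 4)) + (t\<^sup>2 * \<sigma>2 / 2 - \<rho>'))"
        using s_pos[of n] by (intro mult_left_mono) auto
      then show ?thesis by (simp add: E_def mult_exp_exp algebra_simps)
    qed
    ultimately show ?case unfolding A_def by linarith
  qed
qed

text \<open>The rate increases with |y|, so the upper bound depends only on the distance r from 0 to
  the closure: two half-lines cover the set, and no compactness or exponential tightness enters. The
  lower bound fits small balls into the interior.\<close>

lemma MDP_quadratic: "MDP M Z s (\<lambda>y. y\<^sup>2 / (2 * \<sigma>2))"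
  unfolding MDP_def
proof (intro ballI conjI)
  fix A :: "real set" assume A [measurable]: "A \<in> sets borel"
  let ?I = "\<lambda>y. ereal (y\<^sup>2 / (2 * \<sigma>2))"
  let ?S = "scaled_log_prob M Z s A"
  show "liminf ?S \<le> limsup ?S" by (simp add: Liminf_le_Limsup)
  show "- (INF y\<in>interior A. ?I y) \<le> liminf ?S"
  proof -
    have "- ?I y \<le> liminf ?S" if y: "y \<in> interior A" for y
    proof (rule ereal_le_epsilon2)
      fix e :: real assume e: "0 < e"
      obtain \<delta>0 where \<delta>0: "0 < \<delta>0" "ball y \<delta>0 \<subseteq> A" using y by (auto simp: mem_interior)
      \<comment> \<open>The \<open>+ 1\<close> keeps the radius \<delta> positive when y =
        0.\<close>
      define p where "p = \<bar>y\<bar> / \<sigma>2 + 1"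
      define \<delta> where "\<delta> = min \<delta>0 (e / (4 * p))"
      have p: "0 < p" "\<bar>y\<bar> / \<sigma>2 \<le> p" using sigma_pos by (simp_all add: p_def add_nonneg_pos)
      have \<delta>: "0 < \<delta>" using \<delta>0 e p by (simp add: \<delta>_def)
      have "\<bar>y\<bar> / \<sigma>2 * \<delta> \<le> p * (e / (4 * p))"
        using \<delta> p by (intro mult_mono) (auto simp: \<delta>_def)
      also have "\<dots> = e / 4" using p by simp
      finally have small: "\<bar>y\<bar> / \<sigma>2 * \<delta> \<le> e / 4" .
      have "\<forall>\<^sub>F n in sequentially. ereal (- y\<^sup>2 / (2 * \<sigma>2) - e) \<le> ?S n"
        using ball_lower_bound[OF e \<delta> small]
      proof eventually_elim
        case (elim n)
        have "prob {\<omega> \<in> space M. \<bar>Z n \<omega> - y\<bar> < \<delta>} \<le> prob {\<omega> \<in> space M. Z n \<omega> \<in> A}"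
          using \<delta>0(2) by (intro finite_measure_mono) (auto simp: \<delta>_def dist_real_def subset_eq abs_minus_commute)
        then have le: "exp (s n * (- y\<^sup>2 / (2 * \<sigma>2) - e)) \<le> prob {\<omega> \<in> space M. Z n \<omega> \<in> A}"
          using elim by linarith
        then have pp: "0 < prob {\<omega> \<in> space M. Z n \<omega> \<in> A}"
          by (rule less_le_trans[OF exp_gt_zero])
        then have "s n * (- y\<^sup>2 / (2 * \<sigma>2) - e) \<le> ln (prob {\<omega> \<in> space M. Z n \<omega> \<in> A})"
          using le by (simp add: ln_ge_iff)
        then have "- y\<^sup>2 / (2 * \<sigma>2) - e \<le> ln (prob {\<omega> \<in> space M. Z n \<omega> \<in> A}) / s n"
          using s_pos[of n] by (simp add: pos_le_divide_eq mult.commute)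
        then show ?case using pp by (simp add: scaled_log_prob_def Let_def)
      qed
      then have "ereal (- y\<^sup>2 / (2 * \<sigma>2) - e) \<le> liminf ?S"
        by (rule Liminf_bounded)
      then have "ereal (- y\<^sup>2 / (2 * \<sigma>2) - e) + ereal e \<le> liminf ?S + ereal e"
        by (rule add_right_mono)
      then show "- ?I y \<le> liminf ?S + ereal e" by simp
    qed
    then have "- liminf ?S \<le> (INF y\<in>interior A. ?I y)"
      by (intro INF_greatest) (metis ereal_uminus_le_reorder)
    then show ?thesis by (metis ereal_uminus_le_reorder)
  qed
  show "limsup ?S \<le> - (INF y\<in>closure A. ?I y)"
  proof (cases "A = {}")
    case True
    then have "?S = (\<lambda>n. - \<infinity>)" by (simp add: scaled_log_prob_def fun_eq_iff)
    then show ?thesis using True by (simp add: Limsup_const top_ereal_def)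
  next
    case False
    define r where "r = infdist 0 (closure A)"
    have ne: "closure A \<noteq> {}" using False by simp
    obtain y where y: "y \<in> closure A" "r = dist 0 y"
      using infdist_attains_inf[OF closed_closure ne, of 0] unfolding r_def by blast
    have r: "r \<le> \<bar>z\<bar>" if "z \<in> A" for z
    proof -
      have "infdist 0 (closure A) \<le> dist 0 z"
        by (rule infdist_le) (use that closure_subset in blast)
      then show ?thesis by (simp add: r_def)
    qed
    have r0: "0 \<le> r" by (simp add: r_def infdist_nonneg)
    have "limsup ?S \<le> - ?I y"
    proof (rule ereal_le_epsilon2)
      fix e :: real assume e: "0 < e"
      have "\<forall>\<^sub>F n in sequentially. ?S n \<le> ereal (- r\<^sup>2 / (2 * \<sigma>2) + e)"
        using tail_bound[OF r0 e]
      proof eventually_elim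
        case (elim n)
        have "prob {\<omega> \<in> space M. Z n \<omega> \<in> A} \<le> prob {\<omega> \<in> space M. r \<le> \<bar>Z n \<omega>\<bar>}"
          using r by (intro finite_measure_mono) auto
        then have le: "prob {\<omega> \<in> space M. Z n \<omega> \<in> A} \<le> exp (s n * (- r\<^sup>2 / (2 * \<sigma>2) + e))"
          using elim by linarith
        show ?case
        proof (cases "prob {\<omega> \<in> space M. Z n \<omega> \<in> A} = 0")
          case False
          then have pp: "0 < prob {\<omega> \<in> space M. Z n \<omega> \<in> A}" by (simp add: zero_less_measure_iff)
          then have "ln (prob {\<omega> \<in> space M. Z n \<omega> \<in> A}) \<le> s n * (- r\<^sup>2 / (2 * \<sigma>2) + e)"
            using le by (metis ln_exp ln_mono)
          then have "ln (prob {\<omega> \<in> space M. Z n \<omega> \<in> A}) / s n \<le> - r\<^sup>2 / (2 * \<sigma>2) + e"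
            using s_pos[of n] by (simp add: pos_divide_le_eq mult.commute)
          then show ?thesis using False by (simp add: scaled_log_prob_def Let_def)
        qed (simp add: scaled_log_prob_def)
      qed
      then have "limsup ?S \<le> ereal (- r\<^sup>2 / (2 * \<sigma>2) + e)"
        by (rule Limsup_bounded)
      then show "limsup ?S \<le> - ?I y + ereal e" using y(2) by simp
    qed
    also have "\<dots> \<le> - (INF y\<in>closure A. ?I y)"
      using y(1) by (simp only: ereal_minus_le_minus) (rule INF_lower)
    finally show ?thesis .
  qed
qed

end

section \<open>Kernels on the binary tree\<close>

definition bounded_borel :: "('a::topological_space \<Rightarrow> real) \<Rightarrow> bool" where
  "bounded_borel g \<longleftrightarrow> g \<in> borel_measurable borel \<and> (\<exists>B. \<forall>x. \<bar>g x\<bar> \<le> B)"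

lemma bounded_borelI: "g \<in> borel_measurable borel \<Longrightarrow> (\<And>x. \<bar>g x\<bar> \<le> B) \<Longrightarrow> bounded_borel g"
  by (auto simp: bounded_borel_def)

lemma bounded_borelD [measurable_dest]: "bounded_borel g \<Longrightarrow> g \<in> borel_measurable borel"
  by (simp add: bounded_borel_def)

lemma bounded_borel_bound: "bounded_borel g \<Longrightarrow> \<exists>B\<ge>0. \<forall>x. \<bar>g x\<bar> \<le> B"
  unfolding bounded_borel_def by (metis abs_ge_zero order_trans)

lemma bounded_borel_const: "bounded_borel (\<lambda>_. c)"
  by (rule bounded_borelI[where B = "\<bar>c\<bar>"]) auto

lemma bounded_borel_add:
  assumes f: "bounded_borel f" and g: "bounded_borel g" shows "bounded_borel (\<lambda>x. f x + g x)"
proof -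
  obtain B B' where B: "\<And>x. \<bar>f x\<bar> \<le> B" "\<And>x. \<bar>g x\<bar> \<le> B'"
    using f g by (auto simp: bounded_borel_def)
  show ?thesis
  proof (rule bounded_borelI)
    show "\<bar>f x + g x\<bar> \<le> B + B'" for x using B(1)[of x] B(2)[of x] by linarith
  qed (use f g in measurable)
qed

lemma bounded_borel_mult:
  assumes f: "bounded_borel f" and g: "bounded_borel g" shows "bounded_borel (\<lambda>x. f x * g x)"
proof -
  obtain B where B: "0 \<le> B" "\<And>x. \<bar>f x\<bar> \<le> B" using bounded_borel_bound[OF f] by blast
  obtain B' where B': "0 \<le> B'" "\<And>x. \<bar>g x\<bar> \<le> B'" using bounded_borel_bound[OF g] by blast
  show ?thesis
  proof (rule bounded_borelI)
    show "\<bar>f x * g x\<bar> \<le> B * B'" for x unfolding abs_mult using B B' by (intro mult_mono) auto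
  qed (use f g in measurable)
qed

lemma bounded_borel_cmult: "bounded_borel f \<Longrightarrow> bounded_borel (\<lambda>x. c * f x)"
  by (rule bounded_borel_mult[OF bounded_borel_const])

lemma bounded_borel_diff:
  "bounded_borel f \<Longrightarrow> bounded_borel g \<Longrightarrow> bounded_borel (\<lambda>x. f x - g x)"
  using bounded_borel_add[of f "\<lambda>x. - 1 * g x"] bounded_borel_cmult[of g "- 1"] by simp

lemma fst_borel [measurable]:
  "(fst :: 'a::second_countable_topology \<times> 'b::second_countable_topology \<Rightarrow> 'a) \<in> borel \<rightarrow>\<^sub>M borel"
  by (intro borel_measurable_continuous_onI continuous_intros)

lemma snd_borel [measurable]:
  "(snd :: 'a::second_countable_topology \<times> 'b::second_countable_topology \<Rightarrow> 'b) \<in> borel \<rightarrow>\<^sub>M borel"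
  by (intro borel_measurable_continuous_onI continuous_intros)

abbreviation twin :: "('a \<Rightarrow> real) \<Rightarrow> 'a \<times> 'a \<Rightarrow> real" where
  "twin g \<equiv> \<lambda>yz. g (fst yz) + g (snd yz)"

lemma bounded_borel_fst:
  fixes g :: "'a::second_countable_topology \<Rightarrow> real"
  shows "bounded_borel g \<Longrightarrow> bounded_borel (\<lambda>yz :: 'a \<times> 'a. g (fst yz))"
  by (auto simp: bounded_borel_def)

lemma bounded_borel_snd:
  fixes g :: "'a::second_countable_topology \<Rightarrow> real"
  shows "bounded_borel g \<Longrightarrow> bounded_borel (\<lambda>yz :: 'a \<times> 'a. g (snd yz))"
  by (auto simp: bounded_borel_def)

lemma bounded_borel_twin:
  fixes g :: "'a::second_countable_topology \<Rightarrow> real"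
  shows "bounded_borel g \<Longrightarrow> bounded_borel (twin g)"
  by (intro bounded_borel_add bounded_borel_fst bounded_borel_snd)

lemma bounded_borel_exp:
  assumes g: "bounded_borel g" shows "bounded_borel (\<lambda>x. exp (g x))"
proof -
  obtain B where B: "\<And>x. \<bar>g x\<bar> \<le> B" using bounded_borel_bound[OF g] by blast
  have "g x \<le> B" for x using B[of x] by linarith
  then show ?thesis by (intro bounded_borelI[where B = "exp B"]) (use g in auto)
qed

text \<open>One generation of branching on the logarithmic scale. For bounded g, adding a constant m
  to g adds 2 * m here, so nonlinear effects come only from oscillations of g.\<close>

definition free_energy :: "('a \<Rightarrow> ('a \<times> 'a) measure) \<Rightarrow> ('a \<Rightarrow> real) \<Rightarrow> 'a \<Rightarrow> real" where
  "free_energy P g x = ln (\<integral>yz. exp (twin g yz) \<partial>P x)"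

text \<open>The logarithm of the Laplace transform of the additive functional over the subtree of depth \<open>l\<close>
  below a vertex of type \<open>x\<close>; \<open>\<phi> k\<close> is the weight of a vertex at height \<open>k\<close> above the leaves.\<close>
primrec log_laplace :: "('a \<Rightarrow> ('a \<times> 'a) measure) \<Rightarrow> (nat \<Rightarrow> 'a \<Rightarrow> real) \<Rightarrow> nat \<Rightarrow> 'a \<Rightarrow> real" where
  "log_laplace P \<phi> 0 = \<phi> 0"
| "log_laplace P \<phi> (Suc l) = (\<lambda>x. \<phi> (Suc l) x + free_energy P (log_laplace P \<phi> l) x)"

definition twin_variance :: "('a \<Rightarrow> ('a \<times> 'a) measure) \<Rightarrow> ('a \<Rightarrow> real) \<Rightarrow> 'a \<Rightarrow> real" where
  "twin_variance P g x = (\<integral>yz. (twin g yz - 2 * Qop P g x)\<^sup>2 \<partial>P x)"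

section \<open>Integration against the kernel and one step of the recursion\<close>

locale tree_kernel =
  fixes P :: "'a::euclidean_space \<Rightarrow> ('a \<times> 'a) measure"
  assumes kernel: "P \<in> borel \<rightarrow>\<^sub>M prob_algebra borel"
begin

lemma P_sub [measurable]: "P \<in> borel \<rightarrow>\<^sub>M subprob_algebra borel"
  by (rule measurable_prob_algebraD[OF kernel])

lemma prob_P: "prob_space (P x)"
  using measurable_space[OF kernel, of x] by (simp add: space_prob_algebra)

lemma sets_P [measurable_cong, simp]: "sets (P x) = sets borel"
  using measurable_space[OF kernel, of x] by (simp add: space_prob_algebra)

lemma space_P [simp]: "space (P x) = UNIV"
  using sets_eq_imp_space_eq[OF sets_P] by simp

lemma measure_P_UNIV [simp]: "measure (P x) UNIV = 1"
  using prob_space.prob_space[OF prob_P] by simp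

lemma integrable_P: "bounded_borel g \<Longrightarrow> integrable (P x) g"
proof -
  assume g: "bounded_borel g"
  interpret prob_space "P x" by (rule prob_P)
  obtain B where "\<And>x. \<bar>g x\<bar> \<le> B" using g by (auto simp: bounded_borel_def)
  then show ?thesis using g by (intro integrable_const_bound[where B = B]) auto
qed

lemma integral_P_bound:
  assumes "bounded_borel g" "\<And>x. \<bar>g x\<bar> \<le> B" shows "\<bar>\<integral>yz. g yz \<partial>P x\<bar> \<le> B"
proof -
  interpret prob_space "P x" by (rule prob_P)
  have "\<bar>expectation g\<bar> \<le> expectation (\<lambda>yz. \<bar>g yz\<bar>)" by (rule integral_abs_bound)
  also have "\<dots> \<le> expectation (\<lambda>_. B)"
    using integrable_P[OF assms(1)] assms(2) by (intro integral_mono) auto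
  finally show ?thesis by (simp add: prob_space)
qed

lemma bounded_borel_integral_P:
  assumes "bounded_borel g" shows "bounded_borel (\<lambda>x. \<integral>yz. g yz \<partial>P x)"
proof -
  obtain B where B: "\<And>x. \<bar>g x\<bar> \<le> B" using assms by (auto simp: bounded_borel_def)
  have [measurable]: "g \<in> borel_measurable borel" using assms by (rule bounded_borelD)
  show ?thesis
    by (rule bounded_borelI[where B = B]) (use integral_P_bound[OF assms B] in \<open>auto intro: B\<close>)
qed

lemma Qop_twin: "bounded_borel g \<Longrightarrow> 2 * Qop P g x = (\<integral>yz. twin g yz \<partial>P x)"
  unfolding Qop_def by (subst Bochner_Integration.integral_add)
    (auto intro: integrable_P bounded_borel_fst bounded_borel_snd)

lemma bounded_borel_Qop:
  assumes "bounded_borel g" shows "bounded_borel (Qop P g)"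
proof -
  have "Qop P g = (\<lambda>x. 1 / 2 * (\<integral>yz. twin g yz \<partial>P x))"
    by (simp add: fun_eq_iff flip: Qop_twin[OF assms])
  then show ?thesis
    using bounded_borel_cmult[OF bounded_borel_integral_P[OF bounded_borel_twin[OF assms]], of "1 / 2"] by simp
qed

lemma bounded_borel_Qop_iter: "bounded_borel g \<Longrightarrow> bounded_borel ((Qop P ^^ k) g)"
  by (induction k) (auto intro: bounded_borel_Qop)

lemma Qop_add:
  "bounded_borel f \<Longrightarrow> bounded_borel g \<Longrightarrow> Qop P (\<lambda>x. f x + g x) = (\<lambda>x. Qop P f x + Qop P g x)"
  by (simp add: Qop_def fun_eq_iff integrable_P bounded_borel_fst bounded_borel_snd add_divide_distrib)

lemma Qop_cmult: "Qop P (\<lambda>x. c * f x) = (\<lambda>x. c * Qop P f x)"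
  by (simp add: Qop_def fun_eq_iff algebra_simps)

lemma Qop_iter_add:
  assumes "bounded_borel f" "bounded_borel g"
  shows "(Qop P ^^ k) (\<lambda>x. f x + g x) = (\<lambda>x. (Qop P ^^ k) f x + (Qop P ^^ k) g x)"
  by (induction k) (auto simp: Qop_add bounded_borel_Qop_iter assms)

lemma Qop_iter_cmult: "(Qop P ^^ k) (\<lambda>x. c * f x) = (\<lambda>x. c * (Qop P ^^ k) f x)"
  by (induction k) (auto simp: Qop_cmult)

lemma bounded_borel_free_energy:
  assumes "bounded_borel g" shows "bounded_borel (free_energy P g)"
proof -
  obtain B where B: "0 \<le> B" "\<And>x. \<bar>g x\<bar> \<le> B" using bounded_borel_bound[OF assms] by blast
  let ?I = "\<lambda>x. \<integral>yz. exp (twin g yz) \<partial>P x"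
  have tw: "\<bar>twin g yz\<bar> \<le> 2 * B" for yz
    using B(2)[of "fst yz"] B(2)[of "snd yz"] by linarith
  have bb: "bounded_borel (\<lambda>yz. exp (twin g yz))"
    by (intro bounded_borel_exp bounded_borel_twin assms)
  have [measurable]: "?I \<in> borel_measurable borel"
    by (rule bounded_borelD[OF bounded_borel_integral_P[OF bb]])
  have bnd: "exp (- 2 * B) \<le> ?I x" "?I x \<le> exp (2 * B)" for x
  proof -
    interpret prob_space "P x" by (rule prob_P)
    have 1: "exp (- 2 * B) \<le> exp (twin g yz)" "exp (twin g yz) \<le> exp (2 * B)" for yz
      using tw[of yz] by auto
    have "expectation (\<lambda>_. exp (- 2 * B)) \<le> ?I x" "?I x \<le> expectation (\<lambda>_. exp (2 * B))"
      by (rule integral_mono; use 1 integrable_P[OF bb] in simp)+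
    then show "exp (- 2 * B) \<le> ?I x" "?I x \<le> exp (2 * B)" by (simp_all add: prob_space)
  qed
  show ?thesis
  proof (rule bounded_borelI)
    show "\<bar>free_energy P g x\<bar> \<le> 2 * B" for x
    proof -
      have pos: "0 < ?I x" using bnd(1)[of x] by (rule less_le_trans[OF exp_gt_zero])
      have "ln (exp (- 2 * B)) \<le> ln (?I x)" using bnd(1)[of x] pos by (subst ln_le_cancel_iff) auto
      moreover have "ln (?I x) \<le> ln (exp (2 * B))" using bnd(2)[of x] pos by (subst ln_le_cancel_iff) auto
      ultimately show ?thesis by (simp add: free_energy_def abs_le_iff)
    qed
    show "free_energy P g \<in> borel_measurable borel"
      unfolding free_energy_def[abs_def] by measurable
  qed
qed

lemma bounded_borel_log_laplace:
  "(\<And>l. bounded_borel (\<phi> l)) \<Longrightarrow> bounded_borel (log_laplace P \<phi> l)"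
  by (induction l) (auto intro: bounded_borel_add bounded_borel_free_energy)

lemma exp_free_energy:
  assumes "bounded_borel g" shows "exp (free_energy P g x) = (\<integral>yz. exp (twin g yz) \<partial>P x)"
proof -
  interpret prob_space "P x" by (rule prob_P)
  obtain B where B: "0 \<le> B" "\<And>x. \<bar>g x\<bar> \<le> B" using bounded_borel_bound[OF assms] by blast
  have 1: "exp (- 2 * B) \<le> exp (twin g yz)" for yz
    using B(2)[of "fst yz"] B(2)[of "snd yz"] by auto
  have "expectation (\<lambda>_. exp (- 2 * B)) \<le> (\<integral>yz. exp (twin g yz) \<partial>P x)"
    using 1 by (intro integral_mono integrable_P bounded_borel_exp bounded_borel_twin assms bounded_borel_const)
  then have "0 < (\<integral>yz. exp (twin g yz) \<partial>P x)"
    by (simp add: prob_space less_le_trans[OF exp_gt_zero])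
  then show ?thesis by (simp add: free_energy_def)
qed

text \<open>Expresses the variance through the three quantities controlled in (F): for the given
  functions \<open>Q(f^2)\<close> is of order one, while the mixed term and the squared mean are of
  order \<open>h_n^d\<close>.\<close>

lemma twin_variance_eq:
  assumes "bounded_borel g"
  shows "twin_variance P g x =
    2 * Qop P (\<lambda>y. (g y)\<^sup>2) x + 2 * Pop P (\<lambda>y z. g y * g z) x - 4 * (Qop P g x)\<^sup>2"
proof -
  interpret prob_space "P x" by (rule prob_P)
  have sq: "bounded_borel (\<lambda>y. (g y)\<^sup>2)"
    unfolding power2_eq_square by (intro bounded_borel_mult assms)
  have i: "integrable (P x) (twin (\<lambda>y. (g y)\<^sup>2))" "integrable (P x) (\<lambda>yz. g (fst yz) * g (snd yz))"
    "integrable (P x) (twin g)"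
    by (intro integrable_P bounded_borel_twin bounded_borel_mult bounded_borel_fst bounded_borel_snd assms sq)+
  have "twin_variance P g x = (\<integral>yz. twin (\<lambda>y. (g y)\<^sup>2) yz + 2 * (g (fst yz) * g (snd yz))
      - 4 * Qop P g x * twin g yz + 4 * (Qop P g x)\<^sup>2 \<partial>P x)"
    unfolding twin_variance_def by (rule Bochner_Integration.integral_cong) (auto simp: power2_eq_square algebra_simps)
  also have "\<dots> = (\<integral>yz. twin (\<lambda>y. (g y)\<^sup>2) yz \<partial>P x) + 2 * (\<integral>yz. g (fst yz) * g (snd yz) \<partial>P x)
      - 4 * Qop P g x * (\<integral>yz. twin g yz \<partial>P x) + 4 * (Qop P g x)\<^sup>2"
    using i by (simp add: prob_space del: Bochner_Integration.integral_add
        add: Bochner_Integration.integral_add[of "P x" "\<lambda>yz. twin (\<lambda>y. (g y)\<^sup>2) yz + 2 * (g (fst yz) * g (snd yz))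
      - 4 * Qop P g x * twin g yz" "\<lambda>_. 4 * (Qop P g x)\<^sup>2"]
        Bochner_Integration.integral_add[of "P x" "twin (\<lambda>y. (g y)\<^sup>2)" "\<lambda>yz. 2 * (g (fst yz) * g (snd yz))"])
  also have "\<dots> = 2 * Qop P (\<lambda>y. (g y)\<^sup>2) x + 2 * Pop P (\<lambda>y z. g y * g z) x - 4 * (Qop P g x)\<^sup>2"
    unfolding Qop_twin[OF sq, symmetric] Qop_twin[OF assms, symmetric] Pop_def
    by (simp add: power2_eq_square)
  finally show ?thesis .
qed

text \<open>Centring removes the constant m, so t enters only through its oscillation \<tau>. The
  centred sum is at most e in modulus, where \<open>4 * (p + \<tau>)\<close> counts two children and
  their mean; its variance is then compared with that of \<phi> alone.\<close>

lemma free_energy_expansion: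
  assumes \<phi>: "bounded_borel \<phi>" and t: "bounded_borel t"
    and p: "\<And>y. \<bar>\<phi> y\<bar> \<le> p" and \<tau>: "\<And>y. \<bar>t y - m\<bar> \<le> \<tau>" and e: "4 * (p + \<tau>) \<le> e" "e \<le> 1"
    and s: "0 < s" "twin_variance P \<phi> x \<le> s\<^sup>2"
  defines "v \<equiv> \<lambda>y. \<phi> y + t y"
  shows "\<bar>free_energy P v x - 2 * Qop P v x - twin_variance P \<phi> x / 2\<bar> \<le> e * s\<^sup>2 + 12 * s * \<tau> + 24 * \<tau>\<^sup>2"
proof -
  interpret prob_space "P x" by (rule prob_P)
  have v: "bounded_borel v" unfolding v_def by (intro bounded_borel_add \<phi> t)
  have \<tau>0: "0 \<le> \<tau>" and p0: "0 \<le> p" using \<tau>[of x] p[of x] by linarith+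
  define D1 where "D1 = (\<lambda>yz. twin \<phi> yz - 2 * Qop P \<phi> x)"
  define D2 where "D2 = (\<lambda>yz. twin t yz - 2 * Qop P t x)"
  have [measurable]: "\<phi> \<in> borel_measurable borel" "t \<in> borel_measurable borel"
    using \<phi> t by (auto dest: bounded_borelD)
  have [measurable]: "D1 \<in> borel_measurable (P x)" "D2 \<in> borel_measurable (P x)"
    unfolding D1_def D2_def by measurable
  have Q1: "\<bar>2 * Qop P \<phi> x\<bar> \<le> 2 * p"
    unfolding Qop_twin[OF \<phi>]
  proof (rule integral_P_bound[OF bounded_borel_twin[OF \<phi>]])
    show "\<bar>twin \<phi> yz\<bar> \<le> 2 * p" for yz using p[of "fst yz"] p[of "snd yz"] by linarith
  qed
  have D1: "\<bar>D1 yz\<bar> \<le> 4 * p" for yz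
    using p[of "fst yz"] p[of "snd yz"] Q1 unfolding D1_def by linarith
  have Q2: "\<bar>2 * Qop P t x - 2 * m\<bar> \<le> 2 * \<tau>"
  proof -
    have "2 * Qop P t x - 2 * m = (\<integral>yz. twin t yz - 2 * m \<partial>P x)"
      unfolding Qop_twin[OF t] using integrable_P[OF bounded_borel_twin[OF t]] by (simp add: prob_space)
    also have "\<bar>\<dots>\<bar> \<le> 2 * \<tau>"
    proof (rule integral_P_bound)
      show "\<bar>twin t yz - 2 * m\<bar> \<le> 2 * \<tau>" for yz
        using \<tau>[of "fst yz"] \<tau>[of "snd yz"] by linarith
    qed (intro bounded_borel_diff bounded_borel_twin t bounded_borel_const)
    finally show ?thesis .
  qed
  have D2: "\<bar>D2 yz\<bar> \<le> 4 * \<tau>" for yz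
    using \<tau>[of "fst yz"] \<tau>[of "snd yz"] Q2 unfolding D2_def by linarith
  define D where "D = (\<lambda>yz. D1 yz + D2 yz)"
  have [measurable]: "D \<in> borel_measurable (P x)" unfolding D_def by measurable
  have D_eq: "D yz = twin v yz - 2 * Qop P v x" for yz
    by (simp add: D_def D1_def D2_def v_def Qop_add[OF \<phi> t])
  have De: "\<bar>D yz\<bar> \<le> e" for yz
    unfolding D_def using abs_triangle_ineq[of "D1 yz" "D2 yz"] D1[of yz] D2[of yz] e(1)
    by (simp add: distrib_left)
  have mean: "expectation D = 0"
    unfolding D_eq[abs_def] using integrable_P[OF bounded_borel_twin[OF v]] Qop_twin[OF v, of x]
    by (simp add: prob_space)
  have V: "expectation (\<lambda>yz. (D1 yz)\<^sup>2) = twin_variance P \<phi> x"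
    by (simp add: D1_def twin_variance_def)
  define R where "R = 2 * s * (4 * \<tau>) + (4 * \<tau>)\<^sup>2"
  define U where "U = expectation (\<lambda>yz. (D yz)\<^sup>2)"
  have "(\<integral>yz. exp (D yz) \<partial>P x) = exp (- (2 * Qop P v x)) * (\<integral>yz. exp (twin v yz) \<partial>P x)"
    unfolding D_eq by (simp add: exp_diff exp_minus divide_inverse mult.commute)
  also have "\<dots> = exp (free_energy P v x - 2 * Qop P v x)"
    by (simp add: exp_free_energy[OF v, symmetric] mult_exp_exp)
  finally have "free_energy P v x - 2 * Qop P v x = ln (expectation (\<lambda>yz. exp (D yz)))" by simp
  moreover have "\<bar>ln (expectation (\<lambda>yz. exp (D yz))) - U / 2\<bar> \<le> e * U"
    unfolding U_def using De mean e by (intro ln_mgf_quadratic) auto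
  moreover have UR: "\<bar>U - twin_variance P \<phi> x\<bar> \<le> R"
    unfolding U_def D_def V[symmetric] R_def
    using D1 D2 s V by (intro second_moment_perturbation) auto
  moreover have "e * U \<le> e * s\<^sup>2 + R"
  proof -
    have e0: "0 \<le> e" using e \<tau>0 p0 by simp
    have R0: "0 \<le> R" using s \<tau>0 by (simp add: R_def)
    have "U \<le> s\<^sup>2 + R" using s UR by linarith
    then have "e * U \<le> e * (s\<^sup>2 + R)" using e0 by (rule mult_left_mono)
    also have "\<dots> = e * s\<^sup>2 + e * R" by (simp add: distrib_left)
    also have "e * R \<le> R" using mult_right_mono[OF e(2) R0] by simp
    finally show ?thesis by simp
  qed
  \<comment> \<open>Half of R comes from replacing U by the variance of \<phi> in
    \<open>U / 2\<close>, a full R from the remainder \<open>e * U\<close> with e at most 1.\<close>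
  ultimately have "\<bar>free_energy P v x - 2 * Qop P v x - twin_variance P \<phi> x / 2\<bar> \<le> e * s\<^sup>2 + 3 / 2 * R"
    by linarith
  moreover have "3 / 2 * R = 12 * s * \<tau> + 24 * \<tau>\<^sup>2" by (simp add: R_def power2_eq_square)
  ultimately show ?thesis by linarith
qed

end

section \<open>Geometric ergodicity\<close>

locale ergodic_kernel = tree_kernel P + prob_space \<mu>
  for P :: "'a::euclidean_space \<Rightarrow> ('a \<times> 'a) measure" and \<mu> :: "'a measure" +
  fixes Mc \<alpha> :: real
  assumes sets_mu [measurable_cong, simp]: "sets \<mu> = sets borel"
    and inv: "bounded_borel g \<Longrightarrow> (\<integral>x. Qop P g x \<partial>\<mu>) = (\<integral>x. g x \<partial>\<mu>)"
    and Mc: "0 < Mc" and alpha: "0 < \<alpha>"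
    and erg: "bounded_borel g \<Longrightarrow> (\<And>y. \<bar>g y\<bar> \<le> B) \<Longrightarrow>
      \<bar>(Qop P ^^ n) g x - (\<integral>y. g y \<partial>\<mu>)\<bar> \<le> Mc * \<alpha> ^ n * B"
begin

text \<open>A seminorm adapted to the kernel: in it \<open>Q\<close> contracts by the factor \<open>\<alpha>\<close>, which replaces sums
  over all powers of \<open>Q\<close> by one-step recursions.\<close>
definition mixing :: "real \<Rightarrow> ('a \<Rightarrow> real) \<Rightarrow> bool" where
  "mixing c g \<longleftrightarrow> bounded_borel g \<and> (\<forall>k x. \<bar>(Qop P ^^ k) g x - (\<integral>y. g y \<partial>\<mu>)\<bar> \<le> c * \<alpha> ^ k)"

lemma integrable_mu:
  assumes g: "bounded_borel g" shows "integrable \<mu> g"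
proof -
  obtain B where "\<And>x. \<bar>g x\<bar> \<le> B" using bounded_borel_bound[OF g] by blast
  then show ?thesis using g by (intro integrable_const_bound[where B = B]) auto
qed

lemma mixing_bounded: "bounded_borel g \<Longrightarrow> (\<And>y. \<bar>g y\<bar> \<le> B) \<Longrightarrow> mixing (Mc * B) g"
  using erg by (auto simp: mixing_def mult_ac)

lemma mixing_add: "mixing c f \<Longrightarrow> mixing c' g \<Longrightarrow> mixing (c + c') (\<lambda>x. f x + g x)"
proof -
  assume f: "mixing c f" and g: "mixing c' g"
  then have b: "bounded_borel f" "bounded_borel g" by (auto simp: mixing_def)
  have "\<bar>(Qop P ^^ k) (\<lambda>x. f x + g x) x - (\<integral>y. f y + g y \<partial>\<mu>)\<bar> \<le> (c + c') * \<alpha> ^ k" for k x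
  proof -
    have "\<bar>(Qop P ^^ k) f x - (\<integral>y. f y \<partial>\<mu>)\<bar> \<le> c * \<alpha> ^ k" "\<bar>(Qop P ^^ k) g x - (\<integral>y. g y \<partial>\<mu>)\<bar> \<le> c' * \<alpha> ^ k"
      using f g by (auto simp: mixing_def)
    then show ?thesis
      using b by (simp add: Qop_iter_add integrable_mu distrib_right)
  qed
  then show ?thesis using b by (simp add: mixing_def bounded_borel_add)
qed

lemma mixing_cmult: "mixing c g \<Longrightarrow> mixing (\<bar>r\<bar> * c) (\<lambda>x. r * g x)"
  unfolding mixing_def Qop_iter_cmult
  by (auto simp: bounded_borel_cmult mult.assoc abs_mult mult_left_mono simp flip: right_diff_distrib)

text \<open>Shifting k by one yields the factor \<alpha>, and invariance keeps the mean. Bounding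
  only the oscillation of g would bring in the constant Mc at every step.\<close>

lemma mixing_Qop: "mixing c g \<Longrightarrow> mixing (\<alpha> * c) (Qop P g)"
proof -
  assume g: "mixing c g"
  then have b: "bounded_borel g" by (simp add: mixing_def)
  have "\<bar>(Qop P ^^ k) (Qop P g) x - (\<integral>y. Qop P g y \<partial>\<mu>)\<bar> \<le> (\<alpha> * c) * \<alpha> ^ k" for k x
  proof -
    have "\<bar>(Qop P ^^ Suc k) g x - (\<integral>y. g y \<partial>\<mu>)\<bar> \<le> c * \<alpha> ^ Suc k"
      using g unfolding mixing_def by blast
    then show ?thesis by (simp add: inv[OF b] funpow_swap1 mult_ac)
  qed
  then show ?thesis using b by (simp add: mixing_def bounded_borel_Qop)
qed

lemma mixing_mono: "mixing c g \<Longrightarrow> c \<le> c' \<Longrightarrow> mixing c' g"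
  unfolding mixing_def by (meson alpha less_imp_le mult_right_mono order_trans zero_le_power)

lemma mixing_deviation: "mixing c g \<Longrightarrow> \<bar>g x - (\<integral>y. g y \<partial>\<mu>)\<bar> \<le> c"
  unfolding mixing_def by (metis funpow_0 mult.right_neutral power_0)

lemma integral_mu_bound:
  assumes "bounded_borel g" "\<And>x. \<bar>g x\<bar> \<le> B" shows "\<bar>\<integral>y. g y \<partial>\<mu>\<bar> \<le> B"
proof -
  have "\<bar>expectation g\<bar> \<le> expectation (\<lambda>y. \<bar>g y\<bar>)" by (rule integral_abs_bound)
  also have "\<dots> \<le> expectation (\<lambda>_. B)"
    using integrable_mu[OF assms(1)] assms(2) by (intro integral_mono) auto
  finally show ?thesis by (simp add: prob_space)
qed

end

section \<open>Expansion of the log-Laplace recursion\<close>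

text \<open>Here \<open>q\<close> stands for \<open>h\<^sub>n\<close> to the power \<open>d / 2\<close>, \<open>\<phi> l\<close> for the centred function of index \<open>l\<close>
  multiplied by a scalar of modulus \<open>A\<close>, and \<open>g l\<close> for \<open>Q\<close> applied to the square of that function.\<close>
locale additive_functional = ergodic_kernel P \<mu> Mc \<alpha>
  for P :: "'a::euclidean_space \<Rightarrow> ('a \<times> 'a) measure" and \<mu> Mc \<alpha> +
  fixes \<theta> C A q \<eta> :: real and n :: nat and \<phi> g :: "nat \<Rightarrow> 'a \<Rightarrow> real"
  assumes theta: "1 \<le> \<theta>" "\<theta> < 2" "2 * \<alpha> < \<theta>" and C: "1 \<le> C" and q: "0 < q" "q \<le> 1"
    and eta: "0 < \<eta>" and A_eq: "A = \<eta> * q"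
    and q_theta: "q\<^sup>2 * \<theta> ^ n \<le> 1"
    and phi: "\<And>l. bounded_borel (\<phi> l)" and phi_bound: "\<And>l x. l \<le> n \<Longrightarrow> \<bar>\<phi> l x\<bar> \<le> C * \<eta>"
    and phi_Qop: "\<And>l x. l \<le> n \<Longrightarrow> \<bar>Qop P (\<phi> l) x\<bar> \<le> C * A * q"
    and phi_mean: "\<And>l. l \<le> n \<Longrightarrow> (\<integral>x. \<phi> l x \<partial>\<mu>) = 0"
    and g: "\<And>l. bounded_borel (g l)" and g_bound: "\<And>l x. l \<le> n \<Longrightarrow> \<bar>g l x\<bar> \<le> C"
    and phi_variance: "\<And>l x. l \<le> n \<Longrightarrow> \<bar>twin_variance P (\<phi> l) x - 2 * A\<^sup>2 * g l x\<bar> \<le> C * A\<^sup>2 * q\<^sup>2"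
  fixes K :: real
  assumes K_def: "K = 2 * (Mc * (2 * C + 32 * C\<^sup>2)) / (\<theta> - 2 * \<alpha>)"
    and small1: "30 * Mc * K * \<eta> \<le> (\<theta> - 2 * \<alpha>) / 2"
    and small2: "4 * ((C + K) * \<eta>) \<le> 1"
begin

abbreviation "v \<equiv> log_laplace P \<phi>"

text \<open>The contribution of the strict descendants to \<open>v l\<close>; it is 0 at height 0
  because leaves have none.\<close>

definition t :: "nat \<Rightarrow> 'a \<Rightarrow> real" where
  "t l = (case l of 0 \<Rightarrow> (\<lambda>x. 0) | Suc k \<Rightarrow> free_energy P (v k))"

definition w :: "nat \<Rightarrow> 'a \<Rightarrow> real" where
  "w l = (\<lambda>x. free_energy P (v l) x - 2 * Qop P (v l) x)"

text \<open>A supersolution of the oscillation recursion, which has factor 2 * \<alpha> and forcing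
  of order \<open>A * q\<close>. K is twice the forcing constant over the gap \<theta> - 2 *
  \<alpha>: only half of the gap pays for the forcing, the other half for the quadratic
  term.\<close>

definition \<tau> :: "nat \<Rightarrow> real" where
  "\<tau> l = K * A * q * \<theta> ^ l"

lemma K_pos: "0 < K"
  using Mc C theta by (simp add: K_def add_pos_pos)

lemma A: "0 < A"
  using eta q by (simp add: A_eq)

lemma theta_power_ge_1: "1 \<le> \<theta> ^ l"
  using theta by simp

lemma q_theta_le: "l \<le> n \<Longrightarrow> q\<^sup>2 * \<theta> ^ l \<le> 1"
  using q_theta theta by (meson mult_left_mono order_trans power_increasing zero_le_power2)

lemma tau_nonneg: "0 \<le> \<tau> l"
  using K_pos A q theta by (simp add: \<tau>_def)

lemma tau_le: assumes "l \<le> n" shows "\<tau> l \<le> K * \<eta>"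
proof -
  have "\<tau> l = K * \<eta> * (q\<^sup>2 * \<theta> ^ l)" unfolding \<tau>_def by (simp add: A_eq power2_eq_square)
  also have "\<dots> \<le> K * \<eta> * 1"
    using q_theta_le[OF assms] K_pos eta by (intro mult_left_mono) auto
  finally show ?thesis by simp
qed

lemma v_eq: "v l = (\<lambda>x. \<phi> l x + t l x)"
  by (cases l) (auto simp: t_def)

lemma bounded_borel_v: "bounded_borel (v l)"
  by (rule bounded_borel_log_laplace[OF phi])

lemma bounded_borel_t: "bounded_borel (t l)"
  by (cases l) (auto simp: t_def bounded_borel_const intro: bounded_borel_free_energy bounded_borel_v)

lemma bounded_borel_w: "bounded_borel (w l)"
  unfolding w_def by (intro bounded_borel_diff bounded_borel_free_energy bounded_borel_cmult bounded_borel_Qop bounded_borel_v)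

lemma t_Suc: "t (Suc l) = (\<lambda>x. 2 * Qop P (t l) x + (2 * Qop P (\<phi> l) x + w l x))"
proof -
  have "t (Suc l) = free_energy P (v l)" by (simp add: t_def)
  moreover have "2 * Qop P (v l) x = 2 * Qop P (\<phi> l) x + 2 * Qop P (t l) x" for x
    by (simp add: v_eq Qop_add[OF phi bounded_borel_t])
  ultimately show ?thesis by (simp add: w_def fun_eq_iff)
qed

lemma variance_le: "l \<le> n \<Longrightarrow> twin_variance P (\<phi> l) x \<le> (2 * A * C)\<^sup>2"
proof -
  assume l: "l \<le> n"
  have "A\<^sup>2 * g l x \<le> A\<^sup>2 * C" using g_bound[OF l, of x] by (intro mult_left_mono) auto
  moreover have "A\<^sup>2 * C * q\<^sup>2 \<le> A\<^sup>2 * C * 1" using q C by (intro mult_left_mono) (auto simp: power_le_one)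
  ultimately have "twin_variance P (\<phi> l) x \<le> 3 * (A\<^sup>2 * C)"
    using phi_variance[OF l, of x] by (simp only: mult.assoc mult.commute[of C] mult_1_right)
  also have "\<dots> \<le> 4 * (A\<^sup>2 * (C * C))"
    using C by (intro mult_mono) auto
  finally show ?thesis by (simp add: power2_eq_square mult_ac)
qed

lemma w_expansion:
  assumes l: "l \<le> n" and "mixing (\<tau> l) (t l)"
  shows "\<bar>w l x - twin_variance P (\<phi> l) x / 2\<bar> \<le>
    4 * ((C + K) * \<eta>) * (2 * A * C)\<^sup>2 + 12 * (2 * A * C) * \<tau> l + 24 * (\<tau> l)\<^sup>2"
  unfolding w_def v_eq
proof (rule free_energy_expansion[OF phi bounded_borel_t phi_bound[OF l] mixing_deviation[OF assms(2)] _ small2 _ variance_le[OF l]])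
  show "4 * (C * \<eta> + \<tau> l) \<le> 4 * ((C + K) * \<eta>)"
    using tau_le[OF l] by (intro mult_left_mono) (simp_all add: distrib_right)
  show "0 < 2 * A * C" using A C by simp
qed

text \<open>Count of constants: the square of \<open>2 * A * C\<close> receives 1 from the cubic
  remainder, 6 from the split cross term and 1/2 from the variance itself, hence at most 8; the
  square of \<tau> receives 24 + 6.\<close>

lemma w_bound:
  assumes l: "l \<le> n" and "mixing (\<tau> l) (t l)"
  shows "\<bar>w l x\<bar> \<le> 8 * (2 * A * C)\<^sup>2 + 30 * (\<tau> l)\<^sup>2"
proof -
  have "\<bar>w l x - twin_variance P (\<phi> l) x / 2\<bar> \<le>
    4 * ((C + K) * \<eta>) * (2 * A * C)\<^sup>2 + 12 * (2 * A * C) * \<tau> l + 24 * (\<tau> l)\<^sup>2"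
    using w_expansion[OF assms] .
  moreover have "4 * ((C + K) * \<eta>) * (2 * A * C)\<^sup>2 \<le> (2 * A * C)\<^sup>2"
    using mult_right_mono[OF small2, of "(2 * A * C)\<^sup>2"] by simp
  moreover have "12 * (2 * A * C) * \<tau> l \<le> 6 * (2 * A * C)\<^sup>2 + 6 * (\<tau> l)\<^sup>2"
    using sum_squares_bound[of "2 * A * C" "\<tau> l"] by linarith
  moreover have "0 \<le> twin_variance P (\<phi> l) x" by (simp add: twin_variance_def)
  moreover note variance_le[OF l, of x]
  ultimately show ?thesis by linarith
qed

text \<open>Since \<open>2 * \<alpha> < \<theta>\<close> strictly, the quadratic term of the recursion is absorbed into the growth rate \<open>\<theta>\<close>.\<close>
lemma mixing_t: "l \<le> n \<Longrightarrow> mixing (\<tau> l) (t l)"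
proof (induction l)
  case 0
  have "mixing (Mc * 0) (\<lambda>x. 0)" by (rule mixing_bounded[OF bounded_borel_const]) simp
  then show ?case
    using tau_nonneg[of 0] by (auto simp: t_def intro: mixing_mono)
next
  case (Suc l)
  then have l: "l \<le> n" and IH: "mixing (\<tau> l) (t l)" by auto
  define B where "B = 2 * (C * A * q) + (8 * (2 * A * C)\<^sup>2 + 30 * (\<tau> l)\<^sup>2)"
  have "\<bar>2 * Qop P (\<phi> l) x + w l x\<bar> \<le> B" for x
    using phi_Qop[OF l, of x] w_bound[OF l IH, of x] unfolding B_def by linarith
  then have 1: "mixing (Mc * B) (\<lambda>x. 2 * Qop P (\<phi> l) x + w l x)"
    by (intro mixing_bounded bounded_borel_add bounded_borel_cmult bounded_borel_Qop phi bounded_borel_w)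
  have 2: "mixing (2 * (\<alpha> * \<tau> l)) (\<lambda>x. 2 * Qop P (t l) x)"
    using mixing_cmult[OF mixing_Qop[OF IH], of 2] by simp
  have "2 * (\<alpha> * \<tau> l) + Mc * B \<le> \<tau> (Suc l)"
  proof -
    have Aq: "\<eta> \<le> 1"
    proof -
      have "1 * \<eta> \<le> (C + K) * \<eta>"
        using C K_pos eta by (intro mult_right_mono) auto
      then show ?thesis using small2 eta by linarith
    qed
    \<comment> \<open>Since \<open>A = \<eta> * q\<close>, the variance scale \<open>A^2\<close> is
      at most \<open>A * q\<close>, the order of the linear forcing 2 * Q \<phi>.\<close>
    have "(2 * A * C)\<^sup>2 = 4 * C\<^sup>2 * (A * q) * \<eta>"
      by (simp add: A_eq power2_eq_square)
    also have "\<dots> \<le> 4 * C\<^sup>2 * (A * q) * 1"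
      using Aq A q C by (intro mult_left_mono) auto
    finally have s: "(2 * A * C)\<^sup>2 \<le> 4 * C\<^sup>2 * (A * q)" by (simp only: mult_1_right)
    have tt: "(\<tau> l)\<^sup>2 \<le> K * \<eta> * \<tau> l"
      unfolding power2_eq_square using tau_le[OF l] tau_nonneg by (rule mult_right_mono)
    have "(2 * C + 32 * C\<^sup>2) * (A * q) = 2 * (C * A * q) + 8 * (4 * C\<^sup>2 * (A * q))"
      by (simp add: algebra_simps)
    then have "B \<le> (2 * C + 32 * C\<^sup>2) * (A * q) + 30 * (K * \<eta> * \<tau> l)"
      unfolding B_def using s tt by linarith
    then have "Mc * B \<le> Mc * ((2 * C + 32 * C\<^sup>2) * (A * q) + 30 * (K * \<eta> * \<tau> l))"
      using Mc by (intro mult_left_mono) auto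
    also have "\<dots> = Mc * (2 * C + 32 * C\<^sup>2) * (A * q) + 30 * Mc * K * \<eta> * \<tau> l"
      by (simp add: algebra_simps)
    also have "\<dots> \<le> (\<theta> - 2 * \<alpha>) / 2 * \<tau> l + (\<theta> - 2 * \<alpha>) / 2 * \<tau> l"
    proof (rule add_mono)
      show "30 * Mc * K * \<eta> * \<tau> l \<le> (\<theta> - 2 * \<alpha>) / 2 * \<tau> l"
        using small1 tau_nonneg by (rule mult_right_mono)
      have "Mc * (2 * C + 32 * C\<^sup>2) * (A * q) = (\<theta> - 2 * \<alpha>) / 2 * (K * A * q)"
        using theta unfolding K_def by simp
      also have "\<dots> \<le> (\<theta> - 2 * \<alpha>) / 2 * (K * A * q * \<theta> ^ l)"
      proof (rule mult_left_mono)
        have "K * A * q * 1 \<le> K * A * q * \<theta> ^ l"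
          using theta_power_ge_1[of l] K_pos A q by (intro mult_left_mono) auto
        then show "K * A * q \<le> K * A * q * \<theta> ^ l" by simp
      qed (use theta in simp)
      finally show "Mc * (2 * C + 32 * C\<^sup>2) * (A * q) \<le> (\<theta> - 2 * \<alpha>) / 2 * \<tau> l"
        by (simp add: \<tau>_def)
    qed
    also have "\<dots> = (\<theta> - 2 * \<alpha>) * \<tau> l" by (simp add: algebra_simps)
    finally have "2 * (\<alpha> * \<tau> l) + Mc * B \<le> \<theta> * \<tau> l" by (simp add: algebra_simps)
    then show ?thesis by (simp add: \<tau>_def mult_ac)
  qed
  then show ?case
    unfolding t_Suc using mixing_add[OF 2 1] mixing_mono by blast
qed

text \<open>Three sources of error relative to \<open>A^2\<close>: \<eta> from the third-order
  remainder, q from the correlation of \<phi> with the descendants' part, and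
  \<open>q^2 * \<theta>^n\<close> from the square of that part.\<close>

definition rate :: real where
  "rate = \<eta> + q + q\<^sup>2 * \<theta> ^ n"

definition K' :: real where
  "K' = C + 16 * (C + K) * C\<^sup>2 + 24 * C * K + 24 * K\<^sup>2"

text \<open>Half the variance of \<phi> is \<open>A^2 * g\<close> up to a relative error of order
  \<open>q^2\<close>. A loss growing like \<open>\<theta>^l\<close> is acceptable because an error
  at height l is later weighted by 2^(n-l), and \<theta> < 2.\<close>

lemma w_approx:
  assumes l: "l \<le> n" shows "\<bar>w l x - A\<^sup>2 * g l x\<bar> \<le> A\<^sup>2 * (K' * rate) * \<theta> ^ l"
proof -
  define z where "z = q\<^sup>2 * \<theta> ^ n"
  have nn: "0 \<le> \<eta>" "0 \<le> q" "0 \<le> z" "0 \<le> C" "0 \<le> K" "1 \<le> \<theta> ^ l" "0 \<le> A\<^sup>2"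
    using eta q C K_pos theta by (auto simp: z_def)
  have r: "\<eta> \<le> rate * \<theta> ^ l" "q * \<theta> ^ l \<le> rate * \<theta> ^ l" "z * \<theta> ^ l \<le> rate * \<theta> ^ l"
    "q\<^sup>2 \<le> rate * \<theta> ^ l"
  proof -
    have le: "\<eta> \<le> rate" "q \<le> rate" "z \<le> rate" using nn by (auto simp: rate_def z_def)
    then show "q * \<theta> ^ l \<le> rate * \<theta> ^ l" "z * \<theta> ^ l \<le> rate * \<theta> ^ l"
      using nn by (auto intro: mult_right_mono)
    have "rate * 1 \<le> rate * \<theta> ^ l" using le nn by (intro mult_left_mono) auto
    moreover have "q\<^sup>2 \<le> q" using q by (simp add: power2_eq_square mult_left_le)
    ultimately show "\<eta> \<le> rate * \<theta> ^ l" "q\<^sup>2 \<le> rate * \<theta> ^ l" using le by linarith+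
  qed
  \<comment> \<open>One of the two factors \<open>\<theta>^l\<close> is enlarged to
    \<open>\<theta>^n\<close> and absorbed in z; the other is kept.\<close>
  have zl: "(q * \<theta> ^ l)\<^sup>2 \<le> z * \<theta> ^ l"
  proof -
    have "(q * \<theta> ^ l)\<^sup>2 = q\<^sup>2 * \<theta> ^ l * \<theta> ^ l" by (simp add: power2_eq_square)
    also have "\<dots> \<le> z * \<theta> ^ l"
      unfolding z_def using l theta nn by (intro mult_right_mono mult_left_mono power_increasing) auto
    finally show ?thesis .
  qed
  have "\<bar>w l x - A\<^sup>2 * g l x\<bar> \<le> C * A\<^sup>2 * q\<^sup>2 / 2 +
      (4 * ((C + K) * \<eta>) * (2 * A * C)\<^sup>2 + 12 * (2 * A * C) * \<tau> l + 24 * (\<tau> l)\<^sup>2)"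
    using w_expansion[OF l mixing_t[OF l], of x] phi_variance[OF l, of x] by linarith
  also have "\<dots> = A\<^sup>2 * (C / 2 * q\<^sup>2 + 16 * (C + K) * C\<^sup>2 * \<eta> + 24 * C * K * (q * \<theta> ^ l) + 24 * K\<^sup>2 * (q * \<theta> ^ l)\<^sup>2)"
    by (simp add: \<tau>_def power2_eq_square algebra_simps)
  also have "\<dots> \<le> A\<^sup>2 * (C * (rate * \<theta> ^ l) + 16 * (C + K) * C\<^sup>2 * (rate * \<theta> ^ l)
      + 24 * C * K * (rate * \<theta> ^ l) + 24 * K\<^sup>2 * (rate * \<theta> ^ l))"
  proof (intro mult_left_mono add_mono)
    have "C / 2 * q\<^sup>2 \<le> C * q\<^sup>2" using nn by simp
    also have "\<dots> \<le> C * (rate * \<theta> ^ l)" using r nn by (intro mult_left_mono)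
    finally show "C / 2 * q\<^sup>2 \<le> C * (rate * \<theta> ^ l)" .
  qed (use r order_trans[OF zl r(3)] nn in auto)
  also have "\<dots> = A\<^sup>2 * (K' * rate) * \<theta> ^ l"
    by (simp add: K'_def algebra_simps)
  finally show ?thesis .
qed

text \<open>Closed form of the recursion S (l + 1) = 2 * S l + (mean of g l) with S 0 = 0. The sum
  stops before l: the weight at the top vertex of a subtree is determined by the given type and adds
  no variance.\<close>

definition S :: "nat \<Rightarrow> real" where
  "S l = 2 ^ l / 2 * (\<Sum>j<l. (\<integral>x. g j x \<partial>\<mu>) / 2 ^ j)"

lemma S_Suc: "S (Suc l) = 2 * S l + (\<integral>x. g l x \<partial>\<mu>)"
  by (simp add: S_def distrib_left)

text \<open>Under \<mu> the operator Q disappears and \<phi> has mean 0, so the means obey an exact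
  doubling recursion with source w. The last factor of the bound is the sum of
  \<open>2^(l-1-j) * \<theta>^j\<close> over j < l.\<close>

lemma integral_t:
  "l \<le> n \<Longrightarrow> \<bar>(\<integral>x. t l x \<partial>\<mu>) - A\<^sup>2 * S l\<bar> \<le> A\<^sup>2 * (K' * rate) * ((2 ^ l - \<theta> ^ l) / (2 - \<theta>))"
proof (induction l)
  case 0
  then show ?case by (simp add: t_def S_def)
next
  case (Suc l)
  then have l: "l \<le> n" by simp
  let ?B = "A\<^sup>2 * (K' * rate)"
  have "(\<integral>x. t (Suc l) x \<partial>\<mu>) = 2 * (\<integral>x. t l x \<partial>\<mu>) + (2 * (\<integral>x. \<phi> l x \<partial>\<mu>) + (\<integral>x. w l x \<partial>\<mu>))"
    unfolding t_Suc
    by (simp add: integrable_mu bounded_borel_Qop bounded_borel_t phi bounded_borel_w inv)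
  then have eq: "(\<integral>x. t (Suc l) x \<partial>\<mu>) = 2 * (\<integral>x. t l x \<partial>\<mu>) + (\<integral>x. w l x \<partial>\<mu>)"
    using phi_mean[OF l] by simp
  have "\<bar>\<integral>x. w l x - A\<^sup>2 * g l x \<partial>\<mu>\<bar> \<le> ?B * \<theta> ^ l"
    by (rule integral_mu_bound[OF _ w_approx[OF l]]) (intro bounded_borel_diff bounded_borel_w bounded_borel_cmult g)
  then have "\<bar>(\<integral>x. w l x \<partial>\<mu>) - A\<^sup>2 * (\<integral>x. g l x \<partial>\<mu>)\<bar> \<le> ?B * \<theta> ^ l"
    using integrable_mu[OF bounded_borel_w[of l]] integrable_mu[OF g[of l]] by simp
  moreover have "A\<^sup>2 * S (Suc l) = 2 * (A\<^sup>2 * S l) + A\<^sup>2 * (\<integral>x. g l x \<partial>\<mu>)"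
    by (simp add: S_Suc algebra_simps)
  moreover have "?B * ((2 ^ Suc l - \<theta> ^ Suc l) / (2 - \<theta>)) = 2 * (?B * ((2 ^ l - \<theta> ^ l) / (2 - \<theta>))) + ?B * \<theta> ^ l"
  proof -
    have *: "2 ^ Suc l - \<theta> ^ Suc l = 2 * (2 ^ l - \<theta> ^ l) + (2 - \<theta>) * \<theta> ^ l" by (simp add: algebra_simps)
    have "(2 ^ Suc l - \<theta> ^ Suc l) / (2 - \<theta>) = 2 * ((2 ^ l - \<theta> ^ l) / (2 - \<theta>)) + \<theta> ^ l"
      unfolding * add_divide_distrib using theta by simp
    then show ?thesis by (simp only:) (simp add: distrib_left)
  qed
  ultimately show ?case using Suc.IH[OF l] unfolding eq by linarith
qed

text \<open>Uniform in the type x of the root. The oscillation at the root and the root's own weight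
  cost only \<open>(C + K) * \<eta>\<close>, without the factor 2^n.\<close>

lemma log_laplace_approx:
  "\<bar>v n x - A\<^sup>2 * S n\<bar> \<le> (C + K) * \<eta> + A\<^sup>2 * 2 ^ n * (K' / (2 - \<theta>) * rate)"
proof -
  have "0 \<le> K'" "0 \<le> rate"
    using C K_pos eta q theta by (simp_all add: K'_def rate_def)
  then have "A\<^sup>2 * (K' * rate) * ((2 ^ n - \<theta> ^ n) / (2 - \<theta>)) \<le> A\<^sup>2 * (K' * rate) * (2 ^ n / (2 - \<theta>))"
    using theta by (intro mult_left_mono divide_right_mono) auto
  also have "\<dots> = A\<^sup>2 * 2 ^ n * (K' / (2 - \<theta>) * rate)" by simp
  finally have "\<bar>(\<integral>x. t n x \<partial>\<mu>) - A\<^sup>2 * S n\<bar> \<le> A\<^sup>2 * 2 ^ n * (K' / (2 - \<theta>) * rate)"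
    using integral_t[of n] by simp
  moreover have "\<bar>t n x - (\<integral>x. t n x \<partial>\<mu>)\<bar> \<le> K * \<eta>"
    using mixing_deviation[OF mixing_t[of n], of x] tau_le[of n] by simp
  moreover have "\<bar>\<phi> n x\<bar> \<le> C * \<eta>" by (rule phi_bound) simp
  moreover have "(C + K) * \<eta> = C * \<eta> + K * \<eta>" by (rule distrib_right)
  ultimately show ?thesis unfolding v_eq by linarith
qed

end

section \<open>The Laplace transform of a bifurcating Markov chain\<close>

lemma finite_G [simp]: "finite (G k)"
  unfolding G_def using finite_lists_length_eq[of "UNIV :: bool set" k] by simp

lemma G_0: "G 0 = {[]}"
  by (auto simp: G_def)

lemma sum_G_Suc: "(\<Sum>i\<in>G (Suc k). u i) = (\<Sum>i\<in>G k. u (i @ [False]) + u (i @ [True]))" for u :: "bool list \<Rightarrow> real"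
proof -
  have "G (Suc k) = (\<lambda>i. i @ [False]) ` G k \<union> (\<lambda>i. i @ [True]) ` G k"
  proof (intro equalityI subsetI)
    fix j assume "j \<in> G (Suc k)"
    then obtain i c where "j = i @ [c]" "i \<in> G k"
      by (cases j rule: rev_cases) (auto simp: G_def)
    then show "j \<in> (\<lambda>i. i @ [False]) ` G k \<union> (\<lambda>i. i @ [True]) ` G k" by (cases c) auto
  qed (auto simp: G_def)
  then have "(\<Sum>i\<in>G (Suc k). u i) = (\<Sum>i\<in>(\<lambda>i. i @ [False]) ` G k. u i) + (\<Sum>i\<in>(\<lambda>i. i @ [True]) ` G k. u i)"
    by (simp only:) (rule sum.union_disjoint, auto)
  also have "\<dots> = (\<Sum>i\<in>G k. u (i @ [False])) + (\<Sum>i\<in>G k. u (i @ [True]))"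
    by (simp add: sum.reindex inj_on_def)
  finally show ?thesis by (simp add: sum.distrib)
qed

locale bmc = tree_kernel P + prob_space M
  for P :: "'a::euclidean_space \<Rightarrow> ('a \<times> 'a) measure" and M :: "'w measure" +
  fixes X :: "bool list \<Rightarrow> 'w \<Rightarrow> 'a" and \<nu> :: "'a measure"
  assumes bmc: "BMC M X P \<nu>"
begin

lemma X_measurable [measurable]: "X i \<in> borel_measurable M"
  using bmc by (simp add: BMC_def)

definition past :: "nat \<Rightarrow> 'w measure" where
  "past k = sigma (space M) {X j -` A \<inter> space M | j A. j \<in> T k \<and> A \<in> sets borel}"

lemma sets_past: "sets (past k) = sigma_sets (space M) {X j -` A \<inter> space M | j A. j \<in> T k \<and> A \<in> sets borel}"
  unfolding past_def by (rule sets_measure_of) auto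

lemma space_past: "space (past k) = space M"
  unfolding past_def by (rule space_measure_of) auto

lemma subalgebra_past: "subalgebra M (past k)"
  unfolding subalgebra_def space_past sets_past
  by (auto intro!: sets.sigma_sets_subset measurable_sets[OF X_measurable])

lemma X_measurable_past: "j \<in> T k \<Longrightarrow> X j \<in> borel_measurable (past k)"
proof (rule measurableI)
  fix A :: "'a set" assume "j \<in> T k" "A \<in> sets borel"
  then show "X j -` A \<inter> space (past k) \<in> sets (past k)"
    unfolding sets_past space_past by (intro sigma_sets.Basic) auto
qed auto

text \<open>The branching property is applied with edge functions that ignore the parent and equal
  \<open>exp (u y + u z)\<close>; the conditional product is then the exponential of a sum of free
  energies. F carries the weights of the generations up to k.\<close>

lemma integral_generation_step:
  assumes F: "F \<in> borel_measurable (past k)" "\<And>\<omega>. \<bar>F \<omega>\<bar> \<le> B" and u: "bounded_borel u"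
  shows "expectation (\<lambda>\<omega>. F \<omega> * exp (\<Sum>i\<in>G (Suc k). u (X i \<omega>))) =
    expectation (\<lambda>\<omega>. F \<omega> * exp (\<Sum>i\<in>G k. free_energy P u (X i \<omega>)))"
proof -
  interpret finite_measure_subalgebra M "past k"
    by unfold_locales (rule subalgebra_past)
  have [measurable]: "u \<in> borel_measurable borel" using u by (rule bounded_borelD)
  have [measurable]: "F \<in> borel_measurable M" by (rule measurable_from_subalg[OF subalgebra_past F(1)])
  obtain b where b: "0 \<le> b" "\<And>x. \<bar>u x\<bar> \<le> b" using bounded_borel_bound[OF u] by blast
  define H where "H = (\<lambda>\<omega>. \<Prod>i\<in>G k. exp (u (X (i @ [False]) \<omega>) + u (X (i @ [True]) \<omega>)))"
  have H: "H \<omega> = exp (\<Sum>i\<in>G (Suc k). u (X i \<omega>))" for \<omega>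
    by (simp add: H_def sum_G_Suc exp_sum)
  have [measurable]: "H \<in> borel_measurable M" unfolding H_def by measurable
  let ?g = "\<lambda>(i :: bool list) (x :: 'a) y z. exp (u y + u z)"
  have "(\<lambda>(x, y, z). ?g i x y z) \<in> borel_measurable borel" for i
    unfolding split_def by measurable
  moreover have "\<exists>B. \<forall>x y z. \<bar>?g i x y z\<bar> \<le> B" for i
  proof (intro exI[of _ "exp (2 * b)"] allI)
    fix y z show "\<bar>exp (u y + u z)\<bar> \<le> exp (2 * b)"
      using b(2)[of y] b(2)[of z] by simp
  qed
  ultimately have "AE \<omega> in M. real_cond_exp M (past k) H \<omega> = (\<Prod>i\<in>G k. \<integral>yz. exp (twin u yz) \<partial>P (X i \<omega>))"
    using bmc unfolding BMC_def past_def H_def by (elim conjE allE[of _ k] allE[of _ ?g]) blast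
  then have ce: "AE \<omega> in M. real_cond_exp M (past k) H \<omega> = exp (\<Sum>i\<in>G k. free_energy P u (X i \<omega>))"
    by (simp add: exp_sum exp_free_energy[OF u])
  have Hb: "\<bar>H \<omega>\<bar> \<le> exp (real (card (G (Suc k))) * b)" for \<omega>
  proof -
    have "(\<Sum>i\<in>G (Suc k). u (X i \<omega>)) \<le> real (card (G (Suc k))) * b"
      using b(2) by (intro sum_bounded_above) (auto simp: abs_le_iff)
    then show ?thesis by (simp add: H)
  qed
  have int: "integrable M (\<lambda>\<omega>. F \<omega> * H \<omega>)"
  proof (rule integrable_const_bound)
    show "AE \<omega> in M. norm (F \<omega> * H \<omega>) \<le> B * exp (real (card (G (Suc k))) * b)"
    proof (rule AE_I2)
      fix \<omega> show "norm (F \<omega> * H \<omega>) \<le> B * exp (real (card (G (Suc k))) * b)"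
        using mult_mono[OF F(2)[of \<omega>] Hb[of \<omega>]] F(2)[of \<omega>] by (simp add: abs_mult)
    qed
  qed measurable
  have "expectation (\<lambda>\<omega>. F \<omega> * H \<omega>) = expectation (\<lambda>\<omega>. F \<omega> * real_cond_exp M (past k) H \<omega>)"
    by (rule real_cond_exp_intg(2)[symmetric, OF int F(1)]) measurable
  also have "\<dots> = expectation (\<lambda>\<omega>. F \<omega> * exp (\<Sum>i\<in>G k. free_energy P u (X i \<omega>)))"
  proof (rule integral_cong_AE)
    have [measurable]: "free_energy P u \<in> borel_measurable borel"
      by (rule bounded_borelD[OF bounded_borel_free_energy[OF u]])
    show "(\<lambda>\<omega>. F \<omega> * exp (\<Sum>i\<in>G k. free_energy P u (X i \<omega>))) \<in> borel_measurable M" by measurable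
    have [measurable]: "real_cond_exp M (past k) H \<in> borel_measurable M"
      by (rule borel_measurable_cond_exp2)
    show "(\<lambda>\<omega>. F \<omega> * real_cond_exp M (past k) H \<omega>) \<in> borel_measurable M" by measurable
    show "AE \<omega> in M. F \<omega> * real_cond_exp M (past k) H \<omega> = F \<omega> * exp (\<Sum>i\<in>G k. free_energy P u (X i \<omega>))"
      using ce by eventually_elim simp
  qed
  finally show ?thesis by (simp add: H)
qed

text \<open>Generations are integrated out from the leaves upwards. The weights not yet absorbed
  have index l > j, so they sit in generations up to n - j - 1 and are measurable with respect to
  the past at the next step.\<close>

lemma laplace_recursion:
  assumes \<phi>: "\<And>l. bounded_borel (\<phi> l)"
  shows "j \<le> n \<Longrightarrow> expectation (\<lambda>\<omega>. exp (\<Sum>l\<le>n. \<Sum>i\<in>G (n - l). \<phi> l (X i \<omega>))) =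
    expectation (\<lambda>\<omega>. exp (\<Sum>l\<in>{j<..n}. \<Sum>i\<in>G (n - l). \<phi> l (X i \<omega>)) *
      exp (\<Sum>i\<in>G (n - j). log_laplace P \<phi> j (X i \<omega>)))"
proof (induction j)
  case 0
  have "{..n} = insert 0 {0<..n}" by auto
  then have "(\<Sum>l\<le>n. h l) = (\<Sum>l\<in>{0<..n}. h l) + h 0" for h :: "nat \<Rightarrow> real" by simp
  then show ?case by (simp add: exp_add)
next
  case (Suc j)
  define k where "k = n - Suc j"
  have k: "n - j = Suc k" using Suc.prems by (simp add: k_def)
  define F where "F = (\<lambda>\<omega>. exp (\<Sum>l\<in>{j<..n}. \<Sum>i\<in>G (n - l). \<phi> l (X i \<omega>)))"
  have past: "X i \<in> borel_measurable (past k)" if "l \<in> {j<..n}" "i \<in> G (n - l)" for l i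
    by (rule X_measurable_past) (use that in \<open>auto simp: G_def T_def k_def\<close>)
  have F: "F \<in> borel_measurable (past k)"
    unfolding F_def
    by (intro borel_measurable_exp[THEN measurable_compose[rotated]] borel_measurable_sum
        measurable_compose[OF past bounded_borelD[OF \<phi>]])
  obtain b where b: "\<And>l x. \<bar>\<phi> l x\<bar> \<le> b l"
    using bounded_borel_bound[OF \<phi>] by metis
  have Fb: "\<bar>F \<omega>\<bar> \<le> exp (\<Sum>l\<in>{j<..n}. \<Sum>i\<in>G (n - l). b l)" for \<omega>
  proof -
    have "\<phi> l x \<le> b l" for l x using b[of l x] by linarith
    then show ?thesis
      unfolding F_def abs_exp_cancel exp_le_cancel_iff by (intro sum_mono)
  qed
  have "expectation (\<lambda>\<omega>. F \<omega> * exp (\<Sum>i\<in>G (n - j). log_laplace P \<phi> j (X i \<omega>))) =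
    expectation (\<lambda>\<omega>. F \<omega> * exp (\<Sum>i\<in>G k. free_energy P (log_laplace P \<phi> j) (X i \<omega>)))"
    unfolding k by (rule integral_generation_step[OF F Fb bounded_borel_log_laplace[OF \<phi>]])
  moreover have "F \<omega> * exp (\<Sum>i\<in>G k. free_energy P (log_laplace P \<phi> j) (X i \<omega>)) =
      exp (\<Sum>l\<in>{Suc j<..n}. \<Sum>i\<in>G (n - l). \<phi> l (X i \<omega>)) *
      exp (\<Sum>i\<in>G k. log_laplace P \<phi> (Suc j) (X i \<omega>))" for \<omega>
  proof -
    have "{j<..n} = insert (Suc j) {Suc j<..n}" using Suc.prems by auto
    then show ?thesis by (simp add: F_def k_def sum.distrib mult_exp_exp)
  qed
  ultimately show ?case using Suc by (simp add: F_def k_def)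
qed

lemma laplace_eq:
  assumes "\<And>l. bounded_borel (\<phi> l)"
  shows "expectation (\<lambda>\<omega>. exp (\<Sum>l\<le>n. \<Sum>i\<in>G (n - l). \<phi> l (X i \<omega>))) =
    expectation (\<lambda>\<omega>. exp (log_laplace P \<phi> n (X [] \<omega>)))"
  using laplace_recursion[OF assms, of n n] by (simp add: G_0)

text \<open>A bound uniform in the root's type survives averaging over any law of that type, which
  is why the initial distribution is arbitrary.\<close>

lemma ln_laplace_approx:
  assumes \<phi>: "\<And>l. bounded_borel (\<phi> l)" and approx: "\<And>x. \<bar>log_laplace P \<phi> n x - c\<bar> \<le> e"
  shows "\<bar>ln (expectation (\<lambda>\<omega>. exp (\<Sum>l\<le>n. \<Sum>i\<in>G (n - l). \<phi> l (X i \<omega>)))) - c\<bar> \<le> e"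
proof -
  have [measurable]: "log_laplace P \<phi> n \<in> borel_measurable borel"
    by (rule bounded_borelD[OF bounded_borel_log_laplace[OF \<phi>]])
  have le: "c - e \<le> log_laplace P \<phi> n x" "log_laplace P \<phi> n x \<le> c + e" for x
    using approx[of x] by linarith+
  have int: "integrable M (\<lambda>\<omega>. exp (log_laplace P \<phi> n (X [] \<omega>)))"
    by (rule integrable_const_bound[where B = "exp (c + e)"]) (auto simp: le)
  let ?E = "expectation (\<lambda>\<omega>. exp (log_laplace P \<phi> n (X [] \<omega>)))"
  have "expectation (\<lambda>_. exp (c - e)) \<le> ?E" "?E \<le> expectation (\<lambda>_. exp (c + e))"
    by (rule integral_mono; use int le in simp)+
  then have E: "exp (c - e) \<le> ?E" "?E \<le> exp (c + e)" by (simp_all add: prob_space)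
  then have pos: "0 < ?E" using exp_gt_zero less_le_trans by blast
  have "c - e \<le> ln ?E" "ln ?E \<le> c + e"
    using E pos by (simp_all add: ln_ge_iff) (metis ln_exp ln_mono)
  then show ?thesis unfolding laplace_eq[OF \<phi>] by (simp add: abs_le_iff)
qed

end

section \<open>Moderate deviations\<close>

text \<open>Lets the assumptions on the uncentred functions control the variance of the centred and
  scaled ones.\<close>

lemma (in tree_kernel) twin_variance_affine:
  assumes f: "bounded_borel f"
  shows "twin_variance P (\<lambda>x. r * (f x - c)) x = r\<^sup>2 * twin_variance P f x"
proof -
  have Qop_affine: "Qop P (\<lambda>y. r * (f y - c)) x = r * (Qop P f x - c)"
    using Qop_add[OF f bounded_borel_const[of "- c"]] by (simp add: Qop_cmult) (simp add: Qop_def)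
  have "twin_variance P (\<lambda>x. r * (f x - c)) x = (\<integral>yz. r\<^sup>2 * (twin f yz - 2 * Qop P f x)\<^sup>2 \<partial>P x)"
    unfolding twin_variance_def Qop_affine
    by (intro Bochner_Integration.integral_cong) (auto simp: power2_eq_square algebra_simps)
  then show ?thesis by (simp add: twin_variance_def)
qed

theorem mainTheorem5:
  fixes M :: "'w measure"
    and X :: "bool list \<Rightarrow> 'w \<Rightarrow> 'a::euclidean_space"
    and P :: "'a \<Rightarrow> ('a \<times> 'a) measure"
    and \<nu> \<mu> :: "'a measure"
    and Mc \<alpha> \<gamma> \<sigma>2 :: real
    and K :: "'a \<Rightarrow> real"
    and f :: "nat \<Rightarrow> nat \<Rightarrow> 'a \<Rightarrow> real"
    and b :: "nat \<Rightarrow> real"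
  defines "d \<equiv> real DIM('a)"
  defines "h \<equiv> bw \<gamma>"
  assumes bmc: "BMC M X P \<nu>"
    \<comment> \<open>P is a probability kernel from S to S^2\<close>
    and kernel: "P \<in> borel \<rightarrow>\<^sub>M prob_algebra borel"
    \<comment> \<open>(G): Lebesgue density\<close>
    and G_density: "\<exists>p. \<forall>x. p x \<in> borel_measurable lborel \<and> (\<forall>yz. p x yz \<ge> 0) \<and>
                          P x = density lborel (\<lambda>yz. ennreal (p x yz))"
    \<comment> \<open>(G): invariant probability \<mu> of Q\<close>
    and G_mu_prob: "prob_space \<mu>" and G_mu_sets: "sets \<mu> = sets borel"
    and G_mu_inv: "\<And>g. g \<in> borel_measurable borel \<Longrightarrow> (\<exists>B. \<forall>x. \<bar>g x\<bar> \<le> B) \<Longrightarrow>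
                      (\<integral>x. Qop P g x \<partial>\<mu>) = (\<integral>x. g x \<partial>\<mu>)"
    \<comment> \<open>(G): uniform geometric ergodicity\<close>
    and G_M: "Mc > 0" and G_alpha: "0 < \<alpha>" "\<alpha> < 1"
    and G_erg: "\<And>g n x B. g \<in> borel_measurable borel \<Longrightarrow> (\<forall>y. \<bar>g y\<bar> \<le> B) \<Longrightarrow>
                   \<bar>(Qop P ^^ n) g x - (\<integral>y. g y \<partial>\<mu>)\<bar> \<le> Mc * \<alpha> ^ n * B"
    \<comment> \<open>(K)\<close>
    and K_bdd: "\<exists>B. \<forall>x. \<bar>K x\<bar> \<le> B"
    and K_L1: "integrable lborel K"
    and K_L2: "integrable lborel (\<lambda>x. (K x)\<^sup>2)"
    and K_int: "(\<integral>x. K x \<partial>lborel) = 1"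
    and K_tail: "((\<lambda>x. norm x * K x) \<longlongrightarrow> 0) at_infinity"
    and gamma: "0 < \<gamma>" "\<gamma> < 1 / d"
    \<comment> \<open>(F)\<close>
    and F_meas: "\<And>n l. f n l \<in> borel_measurable borel"
    and F_zero: "\<And>n l. n < l \<Longrightarrow> f n l = (\<lambda>x. 0)"
    and F_i: "\<exists>C. \<forall>n. \<forall>l\<le>n. \<forall>x.
                 h n powr (d / 2) * \<bar>f n l x\<bar> \<le> C \<and>
                 h n powr (- d / 2) * \<bar>Qop P (f n l) x\<bar> \<le> C \<and>
                 \<bar>Qop P (\<lambda>y. (f n l y)\<^sup>2) x\<bar> \<le> C \<and>
                 h n powr (- d) * \<bar>Pop P (\<lambda>y z. f n l y * f n l z) x\<bar> \<le> C"
    and F_ii: "\<exists>C. \<forall>n. \<forall>l\<le>n.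
                 h n powr (- d / 2) * (\<integral>x. \<bar>f n l x\<bar> \<partial>\<mu>) \<le> C \<and>
                 (\<integral>x. (f n l x)\<^sup>2 \<partial>\<mu>) \<le> C"
    and F_iii: "(\<lambda>n. \<Sum>l\<le>n. 2 powr (- real l) * (\<integral>x. (f n l x)\<^sup>2 \<partial>\<mu>)) \<longlonglongrightarrow> \<sigma>2"
    and sigma_pos: "\<sigma>2 > 0"
    and alpha_cond: "\<alpha> > 1 / 2 \<Longrightarrow> 2 powr (1 - d * \<gamma>) * \<alpha> < 1"
    \<comment> \<open>the speed sequence\<close>
    and b_pos: "\<And>n. b n > 0"
    and b_inf: "filterlim b at_top sequentially"
    and b_upper: "(\<lambda>n. real n powr (3 / 2) * b n / sqrt (2 ^ n * h n powr d)) \<longlonglongrightarrow> 0"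
    and b_lower: "\<exists>s>0. filterlim (\<lambda>n. b n / sqrt (2 ^ n * h n powr (2 * s + d))) at_top sequentially"
  shows "MDP M
           (\<lambda>n \<omega>. (1 / b n) * ((1 / sqrt (2 ^ n)) *
              (\<Sum>l\<le>n. \<Sum>i\<in>G (n - l). f n l (X i \<omega>) - (\<integral>x. f n l x \<partial>\<mu>))))
           (\<lambda>n. (b n)\<^sup>2)
           (\<lambda>y. y\<^sup>2 / (2 * \<sigma>2))"
proof -
  have d0: "0 < d" by (simp add: d_def)
  interpret M: prob_space M using bmc by (simp add: BMC_def)
  interpret mu: prob_space \<mu> by (rule G_mu_prob)
  interpret bmc P M X \<nu>
    by unfold_locales (rule kernel bmc)+
  interpret ergodic_kernel P \<mu> Mc \<alpha>
    by unfold_locales (use G_mu_sets G_mu_inv G_M G_alpha G_erg in \<open>auto simp: bounded_borel_def\<close>)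
  \<comment> \<open>The ratio of the geometric sequence \<open>h_n^d\<close>; thus
    \<open>q^2 * \<theta>^n\<close> is the n-th power of \<kappa> * \<theta>, and \<theta> must lie
    below 1 / \<kappa>.\<close>
  define \<kappa> where "\<kappa> = 2 powr (- (d * \<gamma>))"
  have \<kappa>: "0 < \<kappa>" "\<kappa> < 1" using d0 gamma by (auto simp: \<kappa>_def powr_less_one)
  obtain \<theta> where theta: "1 \<le> \<theta>" "\<theta> < 2" "2 * \<alpha> < \<theta>" "\<kappa> * \<theta> < 1"
  proof -
    have "2 * \<alpha> * \<kappa> < 1"
    proof (cases "\<alpha> > 1 / 2")
      case True
      then show ?thesis using alpha_cond[OF True] by (simp add: \<kappa>_def powr_diff powr_minus field_simps)
    next
      case False
      then have "2 * \<alpha> * \<kappa> \<le> 1 * \<kappa>" using \<kappa> by (intro mult_right_mono) auto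
      also have "\<dots> < 1" using \<kappa> by simp
      finally show ?thesis .
    qed
    then have "max 1 (2 * \<alpha>) < min 2 (1 / \<kappa>)" using \<kappa> G_alpha by (simp add: field_simps)
    then obtain \<theta> where "max 1 (2 * \<alpha>) < \<theta>" "\<theta> < min 2 (1 / \<kappa>)" using dense by blast
    then show ?thesis using \<kappa> by (intro that[of \<theta>]) (auto simp: field_simps)
  qed
  define q where "q = (\<lambda>n. h n powr (d / 2))"
  have hd: "h n powr d = \<kappa> ^ n" for n
    by (simp add: h_def bw_def \<kappa>_def powr_powr powr_power mult_ac)
  have q2: "(q n)\<^sup>2 = \<kappa> ^ n" for n
    by (simp add: q_def power2_eq_square flip: hd powr_add)
  have q_pos: "0 < q n" for n by (simp add: q_def h_def bw_def)
  have q_sqrt: "q n = sqrt (\<kappa> ^ n)" for n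
    using q2[of n] q_pos[of n] by (metis less_imp_le real_sqrt_unique)
  have q_le: "q n \<le> 1" for n
    unfolding q_sqrt using \<kappa> by (simp add: power_le_one)
  have q_lim: "q \<longlonglongrightarrow> 0"
    unfolding q_sqrt[abs_def] using tendsto_real_sqrt[OF LIMSEQ_power_zero[of \<kappa>]] \<kappa> by simp
  have h_minus: "h n powr (- d / 2) = 1 / q n" "h n powr (- d) = 1 / (q n)\<^sup>2" for n
    unfolding q2 hd[symmetric] by (simp_all add: q_def powr_minus_divide)
  obtain C1' where C1': "\<And>n l x. l \<le> n \<Longrightarrow> h n powr (d / 2) * \<bar>f n l x\<bar> \<le> C1' \<and>
      h n powr (- d / 2) * \<bar>Qop P (f n l) x\<bar> \<le> C1' \<and> \<bar>Qop P (\<lambda>y. (f n l y)\<^sup>2) x\<bar> \<le> C1' \<and>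
      h n powr (- d) * \<bar>Pop P (\<lambda>y z. f n l y * f n l z) x\<bar> \<le> C1'"
    using F_i by blast
  obtain C2' where C2': "\<And>n l. l \<le> n \<Longrightarrow> h n powr (- d / 2) * (\<integral>x. \<bar>f n l x\<bar> \<partial>\<mu>) \<le> C2' \<and>
      (\<integral>x. (f n l x)\<^sup>2 \<partial>\<mu>) \<le> C2'"
    using F_ii by blast
  define C1 where "C1 = \<bar>C1'\<bar>"
  define C2 where "C2 = \<bar>C2'\<bar>"
  have C12: "0 \<le> C1" "0 \<le> C2" by (simp_all add: C1_def C2_def)
  have f_le: "\<bar>f n l x\<bar> \<le> C1 / q n" and Qf_le: "\<bar>Qop P (f n l) x\<bar> \<le> C1 * q n"
    and Qf2_le: "\<bar>Qop P (\<lambda>y. (f n l y)\<^sup>2) x\<bar> \<le> C1"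
    and Pff_le: "\<bar>Pop P (\<lambda>y z. f n l y * f n l z) x\<bar> \<le> C1 * (q n)\<^sup>2" if "l \<le> n" for n l x
  proof -
    have "C1' \<le> C1" by (simp add: C1_def)
    then have *: "q n * \<bar>f n l x\<bar> \<le> C1" "1 / q n * \<bar>Qop P (f n l) x\<bar> \<le> C1"
      "\<bar>Qop P (\<lambda>y. (f n l y)\<^sup>2) x\<bar> \<le> C1" "1 / (q n)\<^sup>2 * \<bar>Pop P (\<lambda>y z. f n l y * f n l z) x\<bar> \<le> C1"
      using C1'[OF that, of x] unfolding h_minus q_def[symmetric, THEN fun_cong] by (auto simp: q_def)
    show "\<bar>f n l x\<bar> \<le> C1 / q n" using *(1) q_pos[of n] by (simp add: pos_le_divide_eq mult.commute)
    show "\<bar>Qop P (f n l) x\<bar> \<le> C1 * q n" using *(2) q_pos[of n] by (simp add: pos_divide_le_eq)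
    show "\<bar>Qop P (\<lambda>y. (f n l y)\<^sup>2) x\<bar> \<le> C1" by (rule *(3))
    show "\<bar>Pop P (\<lambda>y z. f n l y * f n l z) x\<bar> \<le> C1 * (q n)\<^sup>2"
      using *(4) q_pos[of n] by (simp add: pos_divide_le_eq)
  qed
  have f_bb: "bounded_borel (f n l)" for n l
  proof (cases "l \<le> n")
    case True
    then show ?thesis by (intro bounded_borelI[OF F_meas f_le])
  qed (simp add: F_zero bounded_borel_const)
  have f2_bb: "bounded_borel (\<lambda>x. (f n l x)\<^sup>2)" for n l
    unfolding power2_eq_square by (intro bounded_borel_mult f_bb)
  define m where "m = (\<lambda>n l. \<integral>x. f n l x \<partial>\<mu>)"
  have m_le: "\<bar>m n l\<bar> \<le> C2 * q n" if "l \<le> n" for n l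
  proof -
    have "\<bar>m n l\<bar> \<le> (\<integral>x. \<bar>f n l x\<bar> \<partial>\<mu>)" unfolding m_def by (rule integral_abs_bound)
    moreover have "1 / q n * (\<integral>x. \<bar>f n l x\<bar> \<partial>\<mu>) \<le> C2"
      using C2'[OF that] unfolding h_minus C2_def by linarith
    then have "(\<integral>x. \<bar>f n l x\<bar> \<partial>\<mu>) \<le> C2 * q n" using q_pos[of n] by (simp add: pos_divide_le_eq)
    ultimately show ?thesis by linarith
  qed
  have f2_mean: "0 \<le> (\<integral>x. (f n l x)\<^sup>2 \<partial>\<mu>)" "l \<le> n \<Longrightarrow> (\<integral>x. (f n l x)\<^sup>2 \<partial>\<mu>) \<le> C2" for n l
    using C2'[of l n] by (auto simp: C2_def)
  \<comment> \<open>Stops at j < n to match \<open>I.S\<close>, whereas (F)(iii) includes l = n;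
    that term is at most C2 / 2^n.\<close>
  define s where "s = (\<lambda>n. \<Sum>j<n. (\<integral>x. (f n j x)\<^sup>2 \<partial>\<mu>) / 2 ^ j)"
  have s_lim: "s \<longlonglongrightarrow> \<sigma>2"
  proof -
    have eq: "(\<Sum>l\<le>n. 2 powr (- real l) * (\<integral>x. (f n l x)\<^sup>2 \<partial>\<mu>)) - (\<integral>x. (f n n x)\<^sup>2 \<partial>\<mu>) / 2 ^ n = s n" for n
      by (simp add: s_def powr_minus powr_realpow divide_inverse mult.commute flip: lessThan_Suc_atMost)
    have "(\<lambda>n. (\<integral>x. (f n n x)\<^sup>2 \<partial>\<mu>) / 2 ^ n) \<longlonglongrightarrow> 0"
    proof (rule tendsto_sandwich[OF _ _ tendsto_const])
      show "(\<lambda>n. C2 * (1 / 2) ^ n) \<longlonglongrightarrow> 0"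
        by (rule tendsto_mult_right_zero) (simp add: LIMSEQ_power_zero)
      have "(\<integral>x. (f n n x)\<^sup>2 \<partial>\<mu>) / 2 ^ n \<le> C2 / 2 ^ n" for n
        using f2_mean(2)[of n n] by (intro divide_right_mono) auto
      then show "\<forall>\<^sub>F n in sequentially. (\<integral>x. (f n n x)\<^sup>2 \<partial>\<mu>) / 2 ^ n \<le> C2 * (1 / 2) ^ n"
        by (intro always_eventually) (simp add: power_divide)
    qed (use f2_mean(1) in simp)
    then have "(\<lambda>n. (\<Sum>l\<le>n. 2 powr (- real l) * (\<integral>x. (f n l x)\<^sup>2 \<partial>\<mu>)) - (\<integral>x. (f n n x)\<^sup>2 \<partial>\<mu>) / 2 ^ n) \<longlonglongrightarrow> \<sigma>2 - 0"
      by (intro tendsto_diff F_iii)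
    then show ?thesis unfolding eq by simp
  qed
  \<comment> \<open>Up to |r| this is the scale \<eta>: the multiplier \<open>b_n / 2^(n/2)\<close>
    divided by q, where 1 / q is the size of the functions.\<close>
  define \<beta> where "\<beta> = (\<lambda>n. b n / sqrt (2 ^ n * h n powr d))"
  have \<beta>_pos: "0 < \<beta> n" for n
    using b_pos \<kappa> by (simp add: \<beta>_def hd)
  have \<beta>_eq: "\<beta> n * q n = b n / sqrt (2 ^ n)" for n
    using \<kappa> by (simp add: \<beta>_def hd q_sqrt real_sqrt_mult)
  have \<beta>_lim: "\<beta> \<longlonglongrightarrow> 0"
  proof (rule tendsto_sandwich[OF _ _ tendsto_const b_upper])
    show "\<forall>\<^sub>F n in sequentially. \<beta> n \<le> real n powr (3 / 2) * b n / sqrt (2 ^ n * h n powr d)"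
      using eventually_ge_at_top[of 1]
    proof eventually_elim
      case (elim n)
      then have "1 * \<beta> n \<le> real n powr (3 / 2) * \<beta> n"
        using \<beta>_pos[of n] by (intro mult_right_mono ge_one_powr_ge_zero) auto
      then show ?case by (simp add: \<beta>_def)
    qed
  qed (use \<beta>_pos in \<open>simp add: less_imp_le\<close>)
  define Z where "Z = (\<lambda>n \<omega>. (1 / b n) * ((1 / sqrt (2 ^ n)) * (\<Sum>l\<le>n. \<Sum>i\<in>G (n - l). f n l (X i \<omega>) - m n l)))"
  have log_lim: "(\<lambda>n. ln (M.expectation (\<lambda>\<omega>. exp (r * (b n)\<^sup>2 * Z n \<omega>))) / (b n)\<^sup>2) \<longlonglongrightarrow> r\<^sup>2 * \<sigma>2 / 2" for r
  proof (cases "r = 0")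
    \<comment> \<open>Treated apart because the expansion requires \<eta> > 0.\<close>
    case True
    then show ?thesis by (simp add: M.prob_space)
  next
    case False
    \<comment> \<open>Chosen to dominate at once all the bounds collected in
      \<open>C_ge\<close>.\<close>
    define C where "C = 1 + 3 * C1 + 4 * C1\<^sup>2 + C2"
    define K1 where "K1 = 2 * (Mc * (2 * C + 32 * C\<^sup>2)) / (\<theta> - 2 * \<alpha>)"
    define K2 where "K2 = (C + 16 * (C + K1) * C\<^sup>2 + 24 * C * K1 + 24 * K1\<^sup>2) / (2 - \<theta>)"
    define a where "a = (\<lambda>n. r * (b n / sqrt (2 ^ n)))"
    define \<eta> where "\<eta> = (\<lambda>n. \<bar>r\<bar> * \<beta> n)"
    define \<phi> where "\<phi> = (\<lambda>n l x. a n * (f n l x - m n l))"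
    define rate where "rate = (\<lambda>n. \<eta> n + q n + (q n)\<^sup>2 * \<theta> ^ n)"
    have C_ge: "1 \<le> C" "C1 \<le> C" "C1 + C2 \<le> C" "2 * C1 + 4 * C1\<^sup>2 \<le> C"
      using C12 by (simp_all add: C_def)
    have a_abs: "\<bar>a n\<bar> = \<eta> n * q n" for n
      using b_pos[of n] by (simp add: a_def \<eta>_def \<beta>_eq abs_mult mult.assoc)
    have \<eta>_pos: "0 < \<eta> n" for n using False \<beta>_pos by (simp add: \<eta>_def)
    have \<eta>_lim: "\<eta> \<longlonglongrightarrow> 0"
      unfolding \<eta>_def by (rule tendsto_mult_right_zero[OF \<beta>_lim])
    have qt_lim: "(\<lambda>n. (q n)\<^sup>2 * \<theta> ^ n) \<longlonglongrightarrow> 0"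
      unfolding q2 power_mult_distrib[symmetric] using theta \<kappa> by (intro LIMSEQ_power_zero) simp
    have rate_lim: "rate \<longlonglongrightarrow> 0"
      unfolding rate_def using tendsto_add[OF tendsto_add[OF \<eta>_lim q_lim] qt_lim] by simp
    have \<phi>_bb: "bounded_borel (\<phi> n l)" for n l
      unfolding \<phi>_def by (intro bounded_borel_cmult bounded_borel_diff f_bb bounded_borel_const)
    have exponent: "r * (b n)\<^sup>2 * Z n \<omega> = (\<Sum>l\<le>n. \<Sum>i\<in>G (n - l). \<phi> n l (X i \<omega>))" for n \<omega>
    proof -
      have "r * (b n)\<^sup>2 * Z n \<omega> = a n * (\<Sum>l\<le>n. \<Sum>i\<in>G (n - l). f n l (X i \<omega>) - m n l)"
        using b_pos[of n] by (simp add: Z_def a_def power2_eq_square)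
      then show ?thesis by (simp only: \<phi>_def sum_distrib_left)
    qed
    have small1: "\<forall>\<^sub>F n in sequentially. 30 * Mc * K1 * \<eta> n < (\<theta> - 2 * \<alpha>) / 2"
      by (rule order_tendstoD(2)[OF tendsto_mult_right_zero[OF \<eta>_lim]]) (use theta in simp)
    have small2: "\<forall>\<^sub>F n in sequentially. 4 * ((C + K1) * \<eta> n) < 1"
      by (rule order_tendstoD(2)[OF tendsto_mult_right_zero[OF tendsto_mult_right_zero[OF \<eta>_lim]]]) simp
    have small3: "\<forall>\<^sub>F n in sequentially. (q n)\<^sup>2 * \<theta> ^ n < 1"
      by (rule order_tendstoD(2)[OF qt_lim]) simp
    have approx: "\<forall>\<^sub>F n in sequentially.
      \<bar>ln (M.expectation (\<lambda>\<omega>. exp (r * (b n)\<^sup>2 * Z n \<omega>))) - r\<^sup>2 * (b n)\<^sup>2 / 2 * s n\<bar>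
        \<le> (C + K1) * \<eta> n + r\<^sup>2 * (b n)\<^sup>2 * (K2 * rate n)"
      using small1 small2 small3
    proof eventually_elim
      case (elim n)
      interpret I: additive_functional P \<mu> Mc \<alpha> \<theta> C "\<bar>a n\<bar>" "q n" "\<eta> n" n "\<phi> n" "\<lambda>l. Qop P (\<lambda>y. (f n l y)\<^sup>2)" K1
      proof (unfold_locales)
        show "K1 = 2 * (Mc * (2 * C + 32 * C\<^sup>2)) / (\<theta> - 2 * \<alpha>)"
          by (simp add: K1_def)
        show "30 * Mc * K1 * \<eta> n \<le> (\<theta> - 2 * \<alpha>) / 2" using elim(1) by simp
        show "4 * ((C + K1) * \<eta> n) \<le> 1" using elim(2) by simp
        show "bounded_borel (Qop P (\<lambda>y. (f n l y)\<^sup>2))" for l by (intro bounded_borel_Qop f2_bb)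
      next
        fix l x assume l: "l \<le> n"
        \<comment> \<open>The mean is of order q, hence harmless beside a supremum of order 1 /
          q.\<close>
        have fm: "C2 * q n \<le> C2 / q n"
        proof -
          have "q n * q n \<le> 1" using q_le[of n] q_pos[of n] by (simp add: mult_le_one)
          then have "C2 * (q n * q n) \<le> C2 * 1" using C12 by (intro mult_left_mono)
          then show ?thesis using q_pos[of n] by (simp add: pos_le_divide_eq mult.assoc)
        qed
        have "\<bar>f n l x - m n l\<bar> \<le> C1 / q n + C2 / q n"
          using f_le[OF l, of x] m_le[OF l] fm by linarith
        also have "\<dots> \<le> C / q n"
          using C_ge(3) q_pos[of n] by (simp add: divide_right_mono flip: add_divide_distrib)
        finally have "\<bar>a n\<bar> * \<bar>f n l x - m n l\<bar> \<le> \<bar>a n\<bar> * (C / q n)"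
          by (intro mult_left_mono) auto
        also have "\<dots> = C * \<eta> n" using q_pos[of n] by (simp add: a_abs)
        finally show "\<bar>\<phi> n l x\<bar> \<le> C * \<eta> n" by (simp add: \<phi>_def abs_mult)
        have "Qop P (\<lambda>y. f n l y - m n l) x = Qop P (f n l) x - m n l"
          using Qop_add[OF f_bb bounded_borel_const[of "- m n l"], of n l] by (simp add: Qop_def)
        then have "\<bar>Qop P (\<phi> n l) x\<bar> = \<bar>a n\<bar> * \<bar>Qop P (f n l) x - m n l\<bar>"
          by (simp add: \<phi>_def Qop_cmult abs_mult)
        also have "\<dots> \<le> \<bar>a n\<bar> * (C * q n)"
        proof (rule mult_left_mono)
          have "\<bar>Qop P (f n l) x - m n l\<bar> \<le> (C1 + C2) * q n"
            using Qf_le[OF l, of x] m_le[OF l] by (simp add: distrib_right)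
          also have "\<dots> \<le> C * q n" using C_ge q_pos[of n] by (intro mult_right_mono) auto
          finally show "\<bar>Qop P (f n l) x - m n l\<bar> \<le> C * q n" .
        qed simp
        finally show "\<bar>Qop P (\<phi> n l) x\<bar> \<le> C * \<bar>a n\<bar> * q n" by (simp add: mult_ac)
        show "\<bar>Qop P (\<lambda>y. (f n l y)\<^sup>2) x\<bar> \<le> C" using Qf2_le[OF l, of x] C_ge by linarith
        have "twin_variance P (\<phi> n l) x - 2 * \<bar>a n\<bar>\<^sup>2 * Qop P (\<lambda>y. (f n l y)\<^sup>2) x =
            (a n)\<^sup>2 * (2 * Pop P (\<lambda>y z. f n l y * f n l z) x - 4 * (Qop P (f n l) x)\<^sup>2)"
          unfolding \<phi>_def twin_variance_affine[OF f_bb] twin_variance_eq[OF f_bb] by (simp add: algebra_simps)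
        also have "\<bar>\<dots>\<bar> = (a n)\<^sup>2 * \<bar>2 * Pop P (\<lambda>y z. f n l y * f n l z) x - 4 * (Qop P (f n l) x)\<^sup>2\<bar>"
          by (simp add: abs_mult)
        also have "\<dots> \<le> (a n)\<^sup>2 * (C * (q n)\<^sup>2)"
        proof (rule mult_left_mono)
          have "(Qop P (f n l) x)\<^sup>2 \<le> C1\<^sup>2 * (q n)\<^sup>2"
            using power_mono[OF Qf_le[OF l, of x], of 2] by (simp add: power_mult_distrib)
          then have "\<bar>2 * Pop P (\<lambda>y z. f n l y * f n l z) x - 4 * (Qop P (f n l) x)\<^sup>2\<bar>
            \<le> 2 * (C1 * (q n)\<^sup>2) + 4 * (C1\<^sup>2 * (q n)\<^sup>2)"
            using Pff_le[OF l, of x] zero_le_power2[of "Qop P (f n l) x"] by linarith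
          also have "\<dots> = (2 * C1 + 4 * C1\<^sup>2) * (q n)\<^sup>2" by (simp add: distrib_right)
          also have "\<dots> \<le> C * (q n)\<^sup>2" using C_ge by (intro mult_right_mono) auto
          finally show "\<bar>2 * Pop P (\<lambda>y z. f n l y * f n l z) x - 4 * (Qop P (f n l) x)\<^sup>2\<bar> \<le> C * (q n)\<^sup>2" .
        qed simp
        finally show "\<bar>twin_variance P (\<phi> n l) x - 2 * \<bar>a n\<bar>\<^sup>2 * Qop P (\<lambda>y. (f n l y)\<^sup>2) x\<bar>
          \<le> C * \<bar>a n\<bar>\<^sup>2 * (q n)\<^sup>2"
          by (simp add: mult_ac)
      next
        fix l assume "l \<le> n"
        show "(\<integral>x. \<phi> n l x \<partial>\<mu>) = 0"
          using integrable_mu[OF f_bb, of n l] by (simp add: \<phi>_def m_def mu.prob_space)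
      qed (use theta C_ge q_pos q_le \<eta>_pos a_abs elim \<phi>_bb in auto)
      \<comment> \<open>The number of leaves times the squared multiplier is exactly
        \<open>r^2\<close> times the speed.\<close>
      have A2: "\<bar>a n\<bar>\<^sup>2 * 2 ^ n = r\<^sup>2 * (b n)\<^sup>2"
        by (simp add: a_def power_mult_distrib power_divide)
      \<comment> \<open>Invariance turns the mean of \<open>Q(f^2)\<close> into the squared L2 norm
        of f that appears in (F)(iii).\<close>
      have "\<bar>a n\<bar>\<^sup>2 * I.S n = \<bar>a n\<bar>\<^sup>2 * 2 ^ n / 2 * s n"
        by (simp add: I.S_def s_def inv[OF f2_bb])
      then have S_eq: "\<bar>a n\<bar>\<^sup>2 * I.S n = r\<^sup>2 * (b n)\<^sup>2 / 2 * s n"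
        unfolding A2 .
      have K2_eq: "I.K' / (2 - \<theta>) * I.rate = K2 * rate n"
        by (simp add: I.K'_def I.rate_def K2_def rate_def)
      have "\<bar>log_laplace P (\<phi> n) n x - r\<^sup>2 * (b n)\<^sup>2 / 2 * s n\<bar>
        \<le> (C + K1) * \<eta> n + r\<^sup>2 * (b n)\<^sup>2 * (K2 * rate n)" for x
        using I.log_laplace_approx[of x] unfolding A2 S_eq K2_eq .
      then show ?case
        unfolding exponent by (rule ln_laplace_approx[OF \<phi>_bb])
    qed
    have inv_lim: "(\<lambda>n. 1 / (b n)\<^sup>2) \<longlonglongrightarrow> 0"
    proof -
      have "(\<lambda>n. inverse (b n)) \<longlonglongrightarrow> 0" using b_inf by (rule tendsto_inverse_0_at_top)
      from tendsto_power[OF this, of 2] show ?thesis by (simp add: power_inverse divide_inverse)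
    qed
    \<comment> \<open>After division by the speed, the root error carries
      \<open>\<eta> / b_n^2\<close> and the accumulated error carries \<open>rate\<close>; both
      vanish.\<close>
    have "(\<lambda>n. ln (M.expectation (\<lambda>\<omega>. exp (r * (b n)\<^sup>2 * Z n \<omega>))) / (b n)\<^sup>2 - r\<^sup>2 / 2 * s n) \<longlonglongrightarrow> 0"
    proof (rule Lim_null_comparison)
      show "(\<lambda>n. (C + K1) * \<eta> n * (1 / (b n)\<^sup>2) + r\<^sup>2 * (K2 * rate n)) \<longlonglongrightarrow> 0"
        using tendsto_add[OF tendsto_mult[OF tendsto_mult_right_zero[OF \<eta>_lim, of "C + K1"] inv_lim]
          tendsto_mult_right_zero[OF tendsto_mult_right_zero[OF rate_lim, of K2], of "r\<^sup>2"]] by simp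
      show "\<forall>\<^sub>F n in sequentially. norm (ln (M.expectation (\<lambda>\<omega>. exp (r * (b n)\<^sup>2 * Z n \<omega>))) / (b n)\<^sup>2 - r\<^sup>2 / 2 * s n)
        \<le> (C + K1) * \<eta> n * (1 / (b n)\<^sup>2) + r\<^sup>2 * (K2 * rate n)"
        using approx
      proof eventually_elim
        case (elim n)
        define y where "y = ln (M.expectation (\<lambda>\<omega>. exp (r * (b n)\<^sup>2 * Z n \<omega>)))"
        define B where "B = (b n)\<^sup>2"
        have B: "0 < B" using b_pos[of n] by (simp add: B_def)
        have "\<bar>y / B - r\<^sup>2 / 2 * s n\<bar> = \<bar>y - r\<^sup>2 * B / 2 * s n\<bar> / B"
        proof -
          have "y / B - r\<^sup>2 / 2 * s n = (y - r\<^sup>2 * B / 2 * s n) / B" using B by (simp add: diff_divide_distrib)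
          then show ?thesis using B by simp
        qed
        also have "\<dots> \<le> ((C + K1) * \<eta> n + r\<^sup>2 * B * (K2 * rate n)) / B"
          using elim B unfolding y_def B_def by (intro divide_right_mono) auto
        also have "\<dots> = (C + K1) * \<eta> n * (1 / B) + r\<^sup>2 * (K2 * rate n)"
          using B by (simp add: add_divide_distrib)
        finally show ?case by (simp add: y_def B_def)
      qed
    qed
    from tendsto_add[OF this tendsto_mult[OF tendsto_const[of "r\<^sup>2 / 2"] s_lim]] show ?thesis by simp
  qed
  interpret Q: quadratic_log_laplace M Z "\<lambda>n. (b n)\<^sup>2" \<sigma>2
  proof unfold_locales
    show "Z n \<in> borel_measurable M" for n
    proof -
      have [measurable]: "f n l \<in> borel_measurable borel" for l by (rule F_meas)
      show ?thesis unfolding Z_def by measurable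
    qed
    show "\<exists>B. \<forall>\<omega>. \<bar>Z n \<omega>\<bar> \<le> B" for n
    proof -
      have "\<exists>B. \<forall>x. \<bar>f n l x - m n l\<bar> \<le> B" for l
        using bounded_borel_bound[OF bounded_borel_diff[OF f_bb bounded_borel_const]] by blast
      then obtain B where B: "\<And>l x. \<bar>f n l x - m n l\<bar> \<le> B l" by metis
      have "\<bar>\<Sum>l\<le>n. \<Sum>i\<in>G (n - l). f n l (X i \<omega>) - m n l\<bar> \<le> (\<Sum>l\<le>n. \<Sum>i\<in>G (n - l). B l)" for \<omega>
        by (intro order_trans[OF sum_abs] sum_mono B)
      then have "\<bar>Z n \<omega>\<bar> \<le> 1 / b n * (1 / sqrt (2 ^ n) * (\<Sum>l\<le>n. \<Sum>i\<in>G (n - l). B l))" for \<omega>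
        using b_pos[of n] unfolding Z_def abs_mult by (intro mult_mono) auto
      then show ?thesis by blast
    qed
    show "filterlim (\<lambda>n. (b n)\<^sup>2) at_top sequentially"
      using filterlim_pow_at_top[OF _ b_inf, of 2] by simp
    show "0 < (b n)\<^sup>2" for n using b_pos[of n] by simp
  qed (rule sigma_pos log_lim)+
  show ?thesis using Q.MDP_quadratic unfolding Z_def m_def .
qed

end
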